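(* Let $n\ge 1$ and $0\le k\le n$. The sets $\mathfrak B_{\tilde w}=G_k\cap B^+\tilde wB^+$, where $\tilde w$ runs through the signed permutation matrices of size $n$ with $\tilde w^2=1$ and $\operatorname{Tr}\tilde w=n-2k$, are the open cells of a CW structure on the Grassmann manifold $G_k$.
   Context: The Grassmannian of $k$-dimensional subspaces of $\mathbb R^n$ is identified with $G_k=\{g\in O(n): g^2=1,\ \operatorname{Tr} g=n-2k\}$ (an involution $g$ corresponds to its $(-1)$-eigenspace). $B^+$ is the group of real invertible upper triangular $n\times n$ matrices with positive diagonal entries. A signed permutation matrix is a product of a diagonal matrix with entries $\pm1$ and a permutation matrix. *)

theory Defs
  imports "HOL-Analysis.Analysis"
begin

text \<open>The discs and spheres live in \<^const>\<open>Euclidean_space\<close>, so that their dimension is an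
  ordinary natural number. For \<open>d = 0\<close> both discs are a point and the bounding sphere is empty.\<close>

definition closed_disc :: "nat \<Rightarrow> (nat \<Rightarrow> real) topology" where
  "closed_disc d = subtopology (Euclidean_space d) {x. (\<Sum>i<d. (x i)\<^sup>2) \<le> 1}"

definition open_disc :: "nat \<Rightarrow> (nat \<Rightarrow> real) topology" where
  "open_disc d = subtopology (Euclidean_space d) {x. (\<Sum>i<d. (x i)\<^sup>2) < 1}"

definition disc_boundary :: "nat \<Rightarrow> (nat \<Rightarrow> real) set" where
  "disc_boundary d = topspace (closed_disc d) - topspace (open_disc d)"

text \<open>\<open>\<Phi>\<close> is a characteristic map for the \<open>d\<close>-dimensional open cell \<open>e\<close> of \<open>X\<close>.
  The condition on the image of the boundary sphere is part of
  \<open>CW_structure\<close>, since it refers to the other cells.\<close>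

definition characteristic_map :: "'a topology \<Rightarrow> nat \<Rightarrow> 'a set \<Rightarrow> ((nat \<Rightarrow> real) \<Rightarrow> 'a) \<Rightarrow> bool" where
  "characteristic_map X d e \<Phi> \<longleftrightarrow>
     continuous_map (closed_disc d) X \<Phi> \<and>
     homeomorphic_map (open_disc d) (subtopology X e) \<Phi>"

text \<open>Whitehead's definition of a CW structure, for a family of cells \<open>e i\<close> of dimension \<open>dm i\<close>
  indexed by \<open>i \<in> I\<close>: a Hausdorff space partitioned into open cells with characteristic maps,
  closure-finite, and with the weak topology. Cells are nonempty (already by the homeomorphism
  with an open disc), so distinct indices give distinct cells.\<close>

definition CW_structure ::
    "'a topology \<Rightarrow> 'i set \<Rightarrow> ('i \<Rightarrow> 'a set) \<Rightarrow> ('i \<Rightarrow> nat) \<Rightarrow> ('i \<Rightarrow> (nat \<Rightarrow> real) \<Rightarrow> 'a) \<Rightarrow> bool" where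
  "CW_structure X I e dm \<Phi> \<longleftrightarrow>
     Hausdorff_space X \<and>
     disjoint_family_on e I \<and>
     (\<Union>i\<in>I. e i) = topspace X \<and>
     (\<forall>i\<in>I. characteristic_map X (dm i) (e i) (\<Phi> i)) \<and>
     (\<forall>i\<in>I. \<exists>J. finite J \<and> J \<subseteq> {j \<in> I. dm j < dm i} \<and>
               \<Phi> i ` disc_boundary (dm i) \<subseteq> (\<Union>j\<in>J. e j)) \<and>
     (\<forall>A. A \<subseteq> topspace X \<longrightarrow>
        (closedin X A \<longleftrightarrow> (\<forall>i\<in>I. closedin X (A \<inter> X closure_of e i))))"

definition open_cells_of_CW_structure :: "'a topology \<Rightarrow> 'i set \<Rightarrow> ('i \<Rightarrow> 'a set) \<Rightarrow> bool" where
  "open_cells_of_CW_structure X I e \<longleftrightarrow> (\<exists>dm \<Phi>. CW_structure X I e dm \<Phi>)"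

definition Grassmann :: "nat \<Rightarrow> (real^'n^'n) set" where
  "Grassmann k =
     {g. orthogonal_matrix g \<and> g ** g = mat 1 \<and> trace g = real CARD('n) - 2 * real k}"

text \<open>The order of the index type gives the order of rows and columns; the sort matches
  the library's results on determinants of triangular matrices. A finite linear order is
  automatically a well-order, and every size \<open>n \<ge> 1\<close> occurs as \<open>CARD('n)\<close>.\<close>

definition Bplus :: "(real^'n::{finite,wellorder}^'n::{finite,wellorder}) set" where
  "Bplus = {b. invertible b \<and> (\<forall>i j. j < i \<longrightarrow> b $ i $ j = 0) \<and> (\<forall>i. 0 < b $ i $ i)}"

definition sign_diagonal_matrix :: "real^'n^'n \<Rightarrow> bool" where
  "sign_diagonal_matrix D \<longleftrightarrow>
     (\<forall>i j. i \<noteq> j \<longrightarrow> D $ i $ j = 0) \<and> (\<forall>i. D $ i $ i = 1 \<or> D $ i $ i = -1)"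

definition permutation_matrix :: "real^'n^'n \<Rightarrow> bool" where
  "permutation_matrix P \<longleftrightarrow>
     (\<exists>p. p permutes UNIV \<and> P = (\<chi> i j. if i = p j then 1 else 0))"

definition signed_permutation_matrix :: "real^'n^'n \<Rightarrow> bool" where
  "signed_permutation_matrix w \<longleftrightarrow>
     (\<exists>D P. sign_diagonal_matrix D \<and> permutation_matrix P \<and> w = D ** P)"

definition Bruhat_double_coset :: "real^'n::{finite,wellorder}^'n::{finite,wellorder} \<Rightarrow> (real^'n::{finite,wellorder}^'n::{finite,wellorder}) set" where
  "Bruhat_double_coset w = {b ** w ** c | b c. b \<in> Bplus \<and> c \<in> Bplus}"

end

theory Submission
  imports Defs
begin

text \<open>Write \<open>\<sigma>\<close> for the involution underlying \<open>w\<close> and \<open>R t\<close> for the rotation by \<open>t\<close> in two adjacent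
  coordinates \<open>p < q\<close>. If \<open>\<sigma> p > \<sigma> q\<close> and \<open>\<sigma>\<close> does not exchange \<open>p\<close> and \<open>q\<close>, then every orthogonal
  involution in the cell of \<open>w\<close> is uniquely \<open>R t h (R t)\<inverse>\<close> with \<open>0 < t < pi\<close> and \<open>h\<close> in the cell of
  the conjugate \<open>w'\<close> of \<open>w\<close> by \<open>R (pi/2)\<close>, whose dimension is smaller by one. If \<open>\<sigma>\<close> exchanges \<open>p\<close> and
  \<open>q\<close>, the same holds with \<open>R t h\<close> and \<open>w' = R (-pi/2) w\<close>, provided all indices below \<open>p\<close> are fixed: then
  the matrices in the closure of the cell of \<open>w'\<close> are diagonal in the coordinates up to \<open>q\<close>. A
  non-identical \<open>\<sigma>\<close> always admits one of these two reductions, so by induction each cell is the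
  image of an open cube under a map defined on the closed cube. One rotation raises the dimension of
  the cell by at most one, so the faces of the cube go to cells of smaller dimension.\<close>

section \<open>Upper triangular matrices\<close>

text \<open>The closures of the cells are never computed. A rotation by an arbitrary angle sends a
  matrix of the double coset of \<open>x\<close> into the coset of a quarter-turn multiple of
  \<open>x\<close>, so the faces are controlled by comparing the combinatorial dimensions of at most
  four permutations. On the faces \<open>t = 0\<close> and \<open>t = pi\<close> this bound is too
  weak, because \<open>h\<close> may lie in the cell of \<open>w'\<close> itself; there the
  dimension must not rise at all, and it does not, since \<open>R pi\<close> is a diagonal sign
  matrix and normalises \<open>Bplus\<close>. The 2-cycles force two kinds of reduction. If \<sigma>
  exchanges \<open>p\<close> and \<open>q\<close>, conjugation by the quarter turn leaves \<sigma>
  unchanged and cannot lower the dimension; multiplication from one side lowers it, but in general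
  destroys \<open>g ** g = mat 1\<close>. Fixed indices below \<open>p\<close> make \<open>h\<close>
  a reflection in the coordinates \<open>p\<close>, \<open>q\<close>, so that
  \<open>h ** R t = R (- t) ** h\<close> and \<open>R t ** h\<close> is conjugate to
  \<open>h\<close>. Hence both reductions preserve the trace, and this is why the orthogonal
  involutions of one double coset cannot meet two Grassmannians.\<close>

lemma BplusI:
  fixes b :: "real^'n::{finite,wellorder}^'n::{finite,wellorder}"
  assumes "\<And>i j. j < i \<Longrightarrow> b $ i $ j = 0" "\<And>i. 0 < b $ i $ i"
  shows "b \<in> Bplus"
proof -
  have "det b = prod (\<lambda>i. b $ i $ i) UNIV"
    using assms(1) by (intro det_upperdiagonal) auto
  also have "\<dots> > 0" using assms(2) by (intro prod_pos) auto
  finally show ?thesis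
    using assms by (auto simp: Bplus_def invertible_det_nz)
qed

lemma Bplus_upper: "b \<in> Bplus \<Longrightarrow> j < i \<Longrightarrow> b $ i $ j = 0"
  and Bplus_pos: "b \<in> Bplus \<Longrightarrow> 0 < b $ i $ i"
  and Bplus_invertible: "b \<in> Bplus \<Longrightarrow> invertible b"
  by (auto simp: Bplus_def)

lemma mat_1_in_Bplus: "mat 1 \<in> Bplus"
  by (rule BplusI) (auto simp: mat_def)

text \<open>Only row \<open>i\<close> of \<open>b\<close> and column \<open>j\<close> of
  \<open>m\<close> are constrained, so this applies to an \<open>m\<close> not yet known to be
  triangular, such as an inverse.\<close>

lemma upper_mult_diagonal:
  fixes b m :: "real^'n::{finite,wellorder}^'n::{finite,wellorder}"
  assumes "\<And>k. k < i \<Longrightarrow> b $ i $ k = 0" "\<And>k. i < k \<Longrightarrow> m $ k $ j = 0"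
  shows "(b ** m) $ i $ j = b $ i $ i * m $ i $ j"
proof -
  have "(b ** m) $ i $ j = (\<Sum>k\<in>UNIV. b $ i $ k * m $ k $ j)"
    by (simp add: matrix_matrix_mult_def)
  also have "\<dots> = (\<Sum>k\<in>{i}. b $ i $ k * m $ k $ j)"
    using assms by (intro sum.mono_neutral_right) (auto simp: neq_iff)
  finally show ?thesis by simp
qed

lemma Bplus_mult:
  assumes "b \<in> Bplus" "c \<in> Bplus" shows "b ** c \<in> Bplus"
proof (rule BplusI)
  fix i j :: 'a assume "j < i"
  have "b $ i $ k * c $ k $ j = 0" for k
    using Bplus_upper[OF assms(1), of k i] Bplus_upper[OF assms(2), of j k] \<open>j < i\<close>
    by (cases "k < i") auto
  then show "(b ** c) $ i $ j = 0"
    unfolding matrix_matrix_mult_def vec_lambda_beta by (intro sum.neutral) blast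
next
  fix i
  have "(b ** c) $ i $ i = b $ i $ i * c $ i $ i"
    using assms by (intro upper_mult_diagonal) (auto simp: Bplus_upper)
  then show "0 < (b ** c) $ i $ i" using assms by (simp add: Bplus_pos)
qed

lemma Bplus_inverse:
  fixes b :: "real^'n::{finite,wellorder}^'n::{finite,wellorder}"
  assumes b: "b \<in> Bplus"
  obtains b' where "b' \<in> Bplus" "b ** b' = mat 1" "b' ** b = mat 1"
proof -
  obtain m where m: "b ** m = mat 1" "m ** b = mat 1"
    using Bplus_invertible[OF b] by (auto simp: invertible_def)
  have upper: "m $ i $ j = 0" if "j < i" for i j
  proof (rule ccontr)
    assume nz: "m $ i $ j \<noteq> 0"
    define S where "S = {i. j < i \<and> m $ i $ j \<noteq> 0}"
    \<comment> \<open>The lowest nonzero entry of column \<open>j\<close> below the diagonal: row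
      \<open>k\<close> of \<open>b\<close> meets it only at the diagonal of \<open>b\<close>, so it
      survives in \<open>b ** m\<close>, against \<open>b ** m = mat 1\<close>.\<close>
    define k where "k = Max S"
    have "i \<in> S" using that nz by (simp add: S_def)
    then have kS: "k \<in> S" unfolding k_def by (intro Max_in) auto
    have kmax: "m $ l $ j = 0" if "k < l" for l
      using that kS Max_ge[of S l] unfolding k_def S_def by fastforce
    have "(b ** m) $ k $ j = b $ k $ k * m $ k $ j"
      by (intro upper_mult_diagonal) (auto simp: Bplus_upper[OF b] kmax)
    moreover have "(b ** m) $ k $ j = 0" using m(1) kS by (auto simp: mat_def S_def)
    ultimately show False using kS Bplus_pos[OF b, of k] by (auto simp: S_def)
  qed
  have "m \<in> Bplus"
  proof (rule BplusI)
    fix i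
    have "(b ** m) $ i $ i = b $ i $ i * m $ i $ i"
      by (intro upper_mult_diagonal) (auto simp: Bplus_upper[OF b] upper)
    then have "b $ i $ i * m $ i $ i = 1" using m(1) by (simp add: mat_def)
    then show "0 < m $ i $ i" using Bplus_pos[OF b, of i] by (metis zero_less_mult_pos zero_less_one)
  qed (rule upper)
  then show ?thesis using m that by blast
qed

section \<open>Double cosets of the triangular group\<close>

lemma Bruhat_double_cosetI:
  "b \<in> Bplus \<Longrightarrow> c \<in> Bplus \<Longrightarrow> b ** w ** c \<in> Bruhat_double_coset w"
  by (auto simp: Bruhat_double_coset_def)

lemma Bruhat_double_cosetE:
  assumes "g \<in> Bruhat_double_coset w"
  obtains b c where "b \<in> Bplus" "c \<in> Bplus" "g = b ** w ** c"
  using assms by (auto simp: Bruhat_double_coset_def)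

lemma Bruhat_double_coset_self: "w \<in> Bruhat_double_coset w"
  using Bruhat_double_cosetI[OF mat_1_in_Bplus mat_1_in_Bplus, of w]
  by (simp add: matrix_mul_lid matrix_mul_rid)

lemma Bruhat_double_coset_trans:
  assumes "g \<in> Bruhat_double_coset v" "v \<in> Bruhat_double_coset w"
  shows "g \<in> Bruhat_double_coset w"
proof -
  obtain b c where 1: "b \<in> Bplus" "c \<in> Bplus" "g = b ** v ** c"
    using assms(1) by (rule Bruhat_double_cosetE)
  obtain b' c' where 2: "b' \<in> Bplus" "c' \<in> Bplus" "v = b' ** w ** c'"
    using assms(2) by (rule Bruhat_double_cosetE)
  have "g = (b ** b') ** w ** (c' ** c)"
    using 1 2 by (simp add: matrix_mul_assoc)
  then show ?thesis using Bruhat_double_cosetI Bplus_mult 1 2 by metis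
qed

lemma Bruhat_double_coset_sym:
  assumes "g \<in> Bruhat_double_coset w"
  shows "w \<in> Bruhat_double_coset g"
proof -
  obtain b c where 1: "b \<in> Bplus" "c \<in> Bplus" "g = b ** w ** c"
    using assms(1) by (rule Bruhat_double_cosetE)
  obtain b' where b': "b' \<in> Bplus" "b' ** b = mat 1" using Bplus_inverse[OF 1(1)] by metis
  obtain c' where c': "c' \<in> Bplus" "c ** c' = mat 1" using Bplus_inverse[OF 1(2)] by metis
  have "b' ** g ** c' = (b' ** b) ** w ** (c ** c')"
    using 1 by (simp add: matrix_mul_assoc)
  also have "\<dots> = w" by (simp add: b' c' matrix_mul_lid matrix_mul_rid)
  finally show ?thesis using Bruhat_double_cosetI b' c' by metis
qed

lemma orthogonal_matrix_transpose_iff: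
  "orthogonal_matrix (transpose g) \<longleftrightarrow> orthogonal_matrix g"
  by (auto simp: orthogonal_matrix_def)

text \<open>Transposition makes the outer factors lower triangular; but for orthogonal matrices the
  transpose is the inverse, and inverting \<open>b ** w ** c\<close> keeps the outer factors in
  \<open>Bplus\<close>. In this way statements on left factors pass to right factors.\<close>

lemma Bruhat_double_coset_transpose:
  assumes g: "g \<in> Bruhat_double_coset w" "orthogonal_matrix g" and w: "orthogonal_matrix w"
  shows "transpose g \<in> Bruhat_double_coset (transpose w)"
proof -
  obtain b c where 1: "b \<in> Bplus" "c \<in> Bplus" "g = b ** w ** c"
    using g(1) by (rule Bruhat_double_cosetE)
  obtain b' where b': "b' \<in> Bplus" "b ** b' = mat 1" using Bplus_inverse[OF 1(1)] by metis
  obtain c' where c': "c' \<in> Bplus" "c ** c' = mat 1" using Bplus_inverse[OF 1(2)] by metis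
  have "g ** (c' ** transpose w ** b') = b ** (w ** ((c ** c') ** transpose w)) ** b'"
    using 1 by (simp add: matrix_mul_assoc)
  also have "\<dots> = mat 1"
    using w by (simp add: b' c' matrix_mul_lid matrix_mul_rid orthogonal_matrix_def)
  finally have *: "g ** (c' ** transpose w ** b') = mat 1" .
  have "transpose g = transpose g ** (g ** (c' ** transpose w ** b'))"
    by (simp add: * matrix_mul_rid)
  also have "\<dots> = c' ** transpose w ** b'"
    using g(2) by (simp add: orthogonal_matrix_def matrix_mul_assoc matrix_mul_lid)
  finally show ?thesis using Bruhat_double_cosetI b' c' by metis
qed

text \<open>The left factor adds multiples of lower rows to higher ones, the right factor multiples
  of earlier columns to later ones. If \<open>w\<close> vanishes on the rest of the block below and
  to the left of the position, nothing is added there, and only the positive scaling by two diagonal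
  entries remains.\<close>

lemma Bruhat_double_coset_corner:
  assumes g: "g \<in> Bruhat_double_coset w"
    and z: "\<And>i j. i0 \<le> i \<Longrightarrow> j \<le> j0 \<Longrightarrow> (i, j) \<noteq> (i0, j0) \<Longrightarrow> w $ i $ j = 0"
  obtains r where "0 < r" "g $ i0 $ j0 = r * w $ i0 $ j0"
proof -
  obtain b c where 1: "b \<in> Bplus" "c \<in> Bplus" "g = b ** (w ** c)"
    using g by (auto elim: Bruhat_double_cosetE simp: matrix_mul_assoc)
  have tm: "w $ i $ j * c $ j $ j0 = 0" if "i0 \<le> i" "(i, j) \<noteq> (i0, j0)" for i j
    using z[of i j] that Bplus_upper[OF 1(2), of j0 j] by (cases "j \<le> j0") auto
  have below: "(w ** c) $ i $ j0 = 0" if "i0 < i" for i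
    unfolding matrix_matrix_mult_def vec_lambda_beta
    using that by (intro sum.neutral ballI tm) auto
  have "(w ** c) $ i0 $ j0 = (\<Sum>j\<in>UNIV. w $ i0 $ j * c $ j $ j0)"
    by (simp add: matrix_matrix_mult_def)
  also have "\<dots> = (\<Sum>j\<in>{j0}. w $ i0 $ j * c $ j $ j0)"
    using tm by (intro sum.mono_neutral_right) auto
  finally have "g $ i0 $ j0 = b $ i0 $ i0 * (w $ i0 $ j0 * c $ j0 $ j0)"
    unfolding 1(3) using upper_mult_diagonal[of i0 b "w ** c" j0] below Bplus_upper[OF 1(1)] by simp
  then show ?thesis
    using that[of "b $ i0 $ i0 * c $ j0 $ j0"] Bplus_pos[OF 1(1)] Bplus_pos[OF 1(2)]
    by (simp add: mult_ac)
qed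

section \<open>Signed permutations and the Bruhat decomposition\<close>

text \<open>The permutation is made explicit because the dimension of a cell depends on it alone;
  the signs stay in the matrix.\<close>

definition signed_perm :: "real^'n^'n \<Rightarrow> ('n \<Rightarrow> 'n) \<Rightarrow> bool" where
  "signed_perm w \<sigma> \<longleftrightarrow>
     bij \<sigma> \<and> (\<forall>j. \<bar>w $ \<sigma> j $ j\<bar> = 1) \<and> (\<forall>i j. i \<noteq> \<sigma> j \<longrightarrow> w $ i $ j = 0)"

lemma signed_permD:
  assumes "signed_perm w \<sigma>"
  shows "bij \<sigma>" "\<bar>w $ \<sigma> j $ j\<bar> = 1" "i \<noteq> \<sigma> j \<Longrightarrow> w $ i $ j = 0" "\<sigma> j = \<sigma> k \<longleftrightarrow> j = k"
  using assms by (auto simp: signed_perm_def bij_def inj_def)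

lemma signed_perm_nz: "signed_perm w \<sigma> \<Longrightarrow> w $ i $ j \<noteq> 0 \<longleftrightarrow> i = \<sigma> j"
  using signed_permD(2)[of w \<sigma> j] signed_permD(3)[of w \<sigma> i j] by auto

lemma signed_perm_unique: "signed_perm w \<sigma> \<Longrightarrow> signed_perm w \<tau> \<Longrightarrow> \<sigma> = \<tau>"
  using signed_perm_nz[of w] by blast

lemma mult_signed_perm:
  assumes "signed_perm w \<sigma>"
  shows "(m ** w) $ i $ j = m $ i $ \<sigma> j * w $ \<sigma> j $ j"
proof -
  have "(m ** w) $ i $ j = (\<Sum>k\<in>{\<sigma> j}. m $ i $ k * w $ k $ j)"
    unfolding matrix_matrix_mult_def vec_lambda_beta using signed_permD(3)[OF assms]
    by (intro sum.mono_neutral_right) auto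
  then show ?thesis by simp
qed

lemma signed_perm_mult_left:
  assumes "signed_perm w \<sigma>"
  shows "(w ** m) $ \<sigma> i $ j = w $ \<sigma> i $ i * m $ i $ j"
proof -
  have "(w ** m) $ \<sigma> i $ j = (\<Sum>k\<in>{i}. w $ \<sigma> i $ k * m $ k $ j)"
    unfolding matrix_matrix_mult_def vec_lambda_beta using signed_permD[OF assms]
    by (intro sum.mono_neutral_right) auto
  then show ?thesis by simp
qed

lemma signed_perm_mult:
  assumes v: "signed_perm v \<tau>" and w: "signed_perm w \<sigma>"
  shows "signed_perm (v ** w) (\<tau> \<circ> \<sigma>)"
  unfolding signed_perm_def
  using signed_permD[OF v] signed_permD[OF w]
  by (auto simp: mult_signed_perm[OF w] bij_comp abs_mult)

lemma signed_perm_orthogonal: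
  assumes w: "signed_perm w \<sigma>"
  shows "orthogonal_matrix w"
proof -
  have "transpose w ** w = mat 1"
    unfolding vec_eq_iff
  proof (intro allI)
    fix i j
    have sq: "w $ \<sigma> j $ j * w $ \<sigma> j $ j = 1"
      using signed_permD(2)[OF w, of j] by (metis abs_mult_self_eq mult_1)
    show "(transpose w ** w) $ i $ j = mat 1 $ i $ j"
      using sq signed_permD(3)[OF w, of "\<sigma> j" i] signed_permD(4)[OF w, of j i]
      by (auto simp: mult_signed_perm[OF w] transpose_def mat_def)
  qed
  then show ?thesis by (simp add: orthogonal_matrix)
qed

lemma signed_permutation_matrix_iff:
  fixes w :: "real^'n^'n"
  shows "signed_permutation_matrix w \<longleftrightarrow> (\<exists>\<sigma>. signed_perm w \<sigma>)"
proof
  assume "signed_permutation_matrix w"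
  then obtain D P p where D: "sign_diagonal_matrix D" and p: "p permutes UNIV"
    and P: "P = (\<chi> i j. if i = p j then 1 else 0)" and w: "w = D ** P"
    by (auto simp: signed_permutation_matrix_def permutation_matrix_def)
  have "signed_perm D id"
    using D unfolding signed_perm_def sign_diagonal_matrix_def by (auto, metis abs_1 abs_minus_cancel)
  moreover have "signed_perm P p"
    using permutes_bij[OF p] by (auto simp: signed_perm_def P)
  ultimately show "\<exists>\<sigma>. signed_perm w \<sigma>"
    unfolding w using signed_perm_mult by blast
next
  assume "\<exists>\<sigma>. signed_perm w \<sigma>"
  then obtain \<sigma> where s: "signed_perm w \<sigma>" by blast
  define P :: "real^'n^'n" where "P = (\<chi> i j. if i = \<sigma> j then 1 else 0)"
  define D :: "real^'n^'n" where "D = (\<chi> i j. if i = j then w $ i $ (inv \<sigma> i) else 0)"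
  have bij: "bij \<sigma>" using s by (rule signed_permD)
  have surj: "\<sigma> (inv \<sigma> i) = i" for i using bij by (simp add: bij_is_surj surj_f_inv_f)
  have P: "signed_perm P \<sigma>" by (auto simp: signed_perm_def P_def bij)
  have "sign_diagonal_matrix D"
    unfolding sign_diagonal_matrix_def D_def
    using signed_permD(2)[OF s, of "inv \<sigma> _"] surj by (auto simp: abs_eq_iff' abs_if split: if_splits)
       (metis add.inverse_inverse)+
  moreover have "permutation_matrix P"
    unfolding permutation_matrix_def P_def using bij bij_imp_permutes[of \<sigma> UNIV] by auto
  moreover have "w = D ** P"
    unfolding vec_eq_iff mult_signed_perm[OF P]
    using signed_permD(3)[OF s] bij by (auto simp: D_def P_def bij_is_inj inv_f_f)
  ultimately show "signed_permutation_matrix w" unfolding signed_permutation_matrix_def by blast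
qed

text \<open>All bijections have the same sum of ranks \<open>card {..<i}\<close>, so no value can be
  strictly smaller.\<close>

lemma bij_eq_if_le:
  fixes \<sigma> \<tau> :: "'n::{finite,wellorder} \<Rightarrow> 'n"
  assumes "bij \<sigma>" "bij \<tau>" and le: "\<And>j. \<sigma> j \<le> \<tau> j"
  shows "\<sigma> = \<tau>"
proof
  fix j
  let ?r = "\<lambda>i::'n. card {..<i}"
  have "(\<Sum>j\<in>UNIV. ?r (\<sigma> j)) = (\<Sum>j\<in>UNIV. ?r (\<tau> j))"
    using sum.reindex_bij_betw[OF assms(1), of ?r] sum.reindex_bij_betw[OF assms(2), of ?r] by simp
  then have "?r (\<sigma> j) = ?r (\<tau> j)"
    by (rule sum_mono_inv) (use le in \<open>auto intro!: card_mono\<close>)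
  moreover have "{..<\<sigma> j} \<subseteq> {..<\<tau> j}" using le[of j] by auto
  ultimately have "{..<\<sigma> j} = {..<\<tau> j}" by (intro card_subset_eq) auto
  then show "\<sigma> j = \<tau> j" by simp
qed

text \<open>Moving one factor across gives \<open>v ** c' = b ** w\<close>. The entry
  \<open>(\<tau> j, j)\<close> of this equation makes \<open>b $ \<tau> j $ \<sigma> j\<close>
  nonzero, so \<open>\<tau> j \<le> \<sigma> j\<close> for every \<open>j\<close> and the bijections
  agree; the positive diagonals of \<open>b\<close> and \<open>c'\<close> then match the
  signs.\<close>

lemma Bruhat_unique:
  assumes v: "signed_perm v \<tau>" and w: "signed_perm w \<sigma>"
    and g: "g \<in> Bruhat_double_coset v" "g \<in> Bruhat_double_coset w"
  shows "v = w"
proof -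
  have "v \<in> Bruhat_double_coset w"
    using g Bruhat_double_coset_sym Bruhat_double_coset_trans by blast
  then obtain b c where 1: "b \<in> Bplus" "c \<in> Bplus" "v = b ** w ** c"
    by (rule Bruhat_double_cosetE)
  obtain c' where c': "c' \<in> Bplus" "c ** c' = mat 1" using Bplus_inverse[OF 1(2)] by metis
  have "v ** c' = b ** w ** (c ** c')" using 1(3) by (simp add: matrix_mul_assoc)
  then have eq: "v ** c' = b ** w" by (simp add: c' matrix_mul_rid)
  have eqj: "v $ \<tau> j $ j * c' $ j $ j = b $ \<tau> j $ \<sigma> j * w $ \<sigma> j $ j" for j
    using eq signed_perm_mult_left[OF v, of c' j j] mult_signed_perm[OF w, of b "\<tau> j" j] by simp
  have "\<tau> j \<le> \<sigma> j" for j
  proof (rule ccontr)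
    assume "\<not> \<tau> j \<le> \<sigma> j"
    then have "b $ \<tau> j $ \<sigma> j = 0" using Bplus_upper[OF 1(1)] by simp
    then show False
      using eqj[of j] signed_permD(2)[OF v, of j] Bplus_pos[OF c'(1), of j] by auto
  qed
  then have st: "\<tau> = \<sigma>" using bij_eq_if_le signed_permD(1) v w by blast
  have "v $ i $ j = w $ i $ j" for i j
  proof (cases "i = \<sigma> j")
    case True
    have "sgn (v $ i $ j) = sgn (w $ i $ j)"
      using arg_cong[OF eqj[of j], of sgn] Bplus_pos[OF c'(1), of j] Bplus_pos[OF 1(1), of i] True st
      by (simp add: sgn_mult)
    then show ?thesis
      using signed_permD(2)[OF v, of j] signed_permD(2)[OF w, of j] True st by (metis sgn_mult_abs)
  next
    case False
    then show ?thesis using signed_permD(3)[OF v] signed_permD(3)[OF w] st by auto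
  qed
  then show ?thesis by (simp add: vec_eq_iff)
qed

text \<open>Gaussian elimination in extremal form: among the matrices \<open>b ** g\<close>, take
  one whose rows begin as far to the right as possible. Its leading columns are then distinct, and
  \<open>lead m\<close> is the inverse of the permutation sought.\<close>

lemma Bruhat_exists:
  fixes g :: "real^'n::{finite,wellorder}^'n::{finite,wellorder}"
  assumes g: "invertible g"
  obtains w \<sigma> where "signed_perm w \<sigma>" "g \<in> Bruhat_double_coset w"
proof -
  define lead where "lead m i = (LEAST j. m $ i $ j \<noteq> 0)" for m :: "real^'n::{finite,wellorder}^'n::{finite,wellorder}" and i
  define weight where "weight m = (\<Sum>i\<in>UNIV. card {..<lead m i})" for m
  define Q where "Q m \<longleftrightarrow> (\<exists>b\<in>Bplus. m = b ** g)" for m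
  have row: "\<exists>j. m $ i $ j \<noteq> 0" if "Q m" for m i
  proof (rule ccontr)
    assume "\<not> ?thesis"
    then have "row i m = 0" by (simp add: row_def vec_eq_iff)
    then have "det m = 0" by (rule det_zero_row)
    moreover have "det m \<noteq> 0"
      using that g by (auto simp: Q_def invertible_det_nz[symmetric] Bplus_invertible invertible_mult)
    ultimately show False by simp
  qed
  have nz: "m $ i $ lead m i \<noteq> 0" if "Q m" for m i
    unfolding lead_def using row[OF that] by (rule LeastI_ex)
  have z: "m $ i $ j = 0" if "j < lead m i" for m i j
    using not_less_Least[of j "\<lambda>j. m $ i $ j \<noteq> 0"] that by (auto simp: lead_def)
  have "weight m \<le> (\<Sum>i\<in>(UNIV::'n set). CARD('n))" for m
    unfolding weight_def by (intro sum_mono card_mono) auto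
  then have bound: "\<forall>m. Q m \<longrightarrow> weight m < Suc (CARD('n) * CARD('n))"
    by (simp add: less_Suc_eq_le)
  have "Q g" unfolding Q_def using mat_1_in_Bplus matrix_mul_lid[of g] by metis
  then obtain m where Qm: "Q m" and max: "\<And>m'. Q m' \<Longrightarrow> weight m' \<le> weight m"
    using ex_has_greatest_nat[of Q g weight, OF _ bound] by blast
  \<comment> \<open>If two rows had the same leading column, subtracting a multiple of the lower one from the
    upper one would increase the weight.\<close>
  have inj: "lead m i \<noteq> lead m i'" if "i < i'" for i i'
  proof
    assume eq: "lead m i = lead m i'"
    define l where "l = lead m i"
    define t where "t = m $ i $ l / m $ i' $ l"
    define u :: "real^'n::{finite,wellorder}^'n::{finite,wellorder}" where
      "u = (\<chi> a k. (if k = a then 1 else 0) - (if k = i' then if a = i then t else 0 else 0))"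
    have u: "u \<in> Bplus" using that by (intro BplusI) (auto simp: u_def)
    have um: "(u ** m) $ a $ j = m $ a $ j - (if a = i then t * m $ i' $ j else 0)" for a j
      by (simp add: matrix_matrix_mult_def u_def left_diff_distrib sum_subtractf if_distrib[of "\<lambda>x. x * _"] cong: if_cong)
    have Qu: "Q (u ** m)"
      using Qm u Bplus_mult unfolding Q_def by (metis matrix_mul_assoc)
    have "(u ** m) $ i $ j = 0" if "j \<le> l" for j
    proof (cases "j = l")
      case True
      then show ?thesis using nz[OF Qm, of i'] eq by (simp add: um t_def l_def)
    next
      case False
      then show ?thesis using that z[of j m i] z[of j m i'] eq by (simp add: um l_def)
    qed
    then have "l < lead (u ** m) i" using nz[OF Qu, of i] by (meson not_le)
    then have *: "card {..<lead m i} < card {..<lead (u ** m) i}"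
      unfolding l_def by (intro psubset_card_mono) auto
    have "lead (u ** m) a = lead m a" if "a \<noteq> i" for a
      using that by (simp add: lead_def um)
    then have "card {..<lead m a} \<le> card {..<lead (u ** m) a}" for a
      using * by (cases "a = i") auto
    then have "weight m < weight (u ** m)"
      unfolding weight_def using * by (intro sum_strict_mono_ex1) auto
    then show False using max[OF Qu] by simp
  qed
  then have "inj (lead m)" by (metis injI linorder_neq_iff)
  then have bij: "bij (lead m)" by (simp add: bij_def finite_UNIV_inj_surj)
  define w :: "real^'n::{finite,wellorder}^'n::{finite,wellorder}" where "w = (\<chi> i j. if j = lead m i then sgn (m $ i $ j) else 0)"
  have inv: "inv (lead m) (lead m i) = i" "lead m (inv (lead m) j) = j" for i j
    using bij by (auto simp: bij_is_inj bij_is_surj surj_f_inv_f)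
  have w: "signed_perm w (inv (lead m))"
    unfolding signed_perm_def using bij nz[OF Qm] inv
    by (auto simp: w_def bij_imp_bij_inv abs_sgn_eq) (metis inv(2))
  \<comment> \<open>Row \<open>j\<close> of \<open>c\<close> is, up to sign, the row of
    \<open>m\<close> that begins in column \<open>j\<close>; the sign of the leading entry makes the
    diagonal positive.\<close>
  define c where "c = transpose w ** m"
  have c: "c $ j $ k = sgn (m $ (inv (lead m) j) $ j) * m $ (inv (lead m) j) $ k" for j k
  proof -
    have "c $ j $ k = (\<Sum>i\<in>UNIV. w $ i $ j * m $ i $ k)"
      by (simp add: c_def matrix_matrix_mult_def transpose_def)
    also have "\<dots> = (\<Sum>i\<in>{inv (lead m) j}. w $ i $ j * m $ i $ k)"
      using signed_permD(3)[OF w] by (intro sum.mono_neutral_right) auto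
    finally show ?thesis by (simp add: w_def inv)
  qed
  have "c \<in> Bplus"
  proof (rule BplusI)
    show "c $ i $ j = 0" if "j < i" for i j
      using that z[of j m "inv (lead m) i"] by (simp add: c inv)
    show "0 < c $ i $ i" for i
      using nz[OF Qm, of "inv (lead m) i"] by (simp add: c inv mult.commute[of "sgn _"] flip: abs_sgn)
  qed
  moreover have "m = w ** c"
    using signed_perm_orthogonal[OF w] unfolding c_def orthogonal_matrix_def
    by (metis matrix_mul_assoc matrix_mul_lid)
  ultimately have "m \<in> Bruhat_double_coset w"
    using Bruhat_double_cosetI[OF mat_1_in_Bplus, of c w] by (simp add: matrix_mul_lid)
  moreover have "m \<in> Bruhat_double_coset g"
  proof -
    obtain b where "b \<in> Bplus" "m = b ** g" using Qm by (auto simp: Q_def)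
    then show ?thesis using Bruhat_double_cosetI[OF _ mat_1_in_Bplus, of b g] by (simp add: matrix_mul_rid)
  qed
  ultimately have "g \<in> Bruhat_double_coset w"
    using Bruhat_double_coset_sym Bruhat_double_coset_trans by blast
  then show ?thesis using that w by blast
qed

section \<open>Rotations in two adjacent coordinates\<close>

lemma signed_perm_mat_1: "signed_perm (mat 1) id"
  by (auto simp: signed_perm_def mat_def)

lemma signed_perm_transpose:
  assumes w: "signed_perm w \<sigma>" shows "signed_perm (transpose w) (inv \<sigma>)"
proof -
  have bij: "bij \<sigma>" using w by (rule signed_permD)
  have 1: "\<sigma> (inv \<sigma> i) = i" for i using bij by (simp add: bij_is_surj surj_f_inv_f)
  show ?thesis
    unfolding signed_perm_def transpose_def
    using signed_permD(2)[OF w, of "inv \<sigma> _"] signed_permD(3)[OF w] bij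
    by (auto simp: bij_imp_bij_inv 1) (metis bij_is_inj inv_f_f)
qed

text \<open>Split into terms that each single out one column \<open>k\<close>, so that the sums in
  matrix products collapse.\<close>

definition rotation :: "'n \<Rightarrow> 'n \<Rightarrow> real \<Rightarrow> real^'n^'n" where
  "rotation p q t = (\<chi> i k. (if k = i then if i = p \<or> i = q then cos t else 1 else 0)
     + (if k = q then if i = p then - sin t else 0 else 0)
     + (if k = p then if i = q then sin t else 0 else 0))"

lemma polar:
  fixes x y :: real
  assumes "(x, y) \<noteq> (0, 0)"
  obtains r t where "0 < r" "0 \<le> t" "t < 2 * pi" "x = r * cos t" "y = r * sin t"
proof -
  define r where "r = sqrt (x\<^sup>2 + y\<^sup>2)"
  have r: "0 < r" using assms unfolding r_def by (auto simp: sum_power2_gt_zero_iff)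
  have r2: "r\<^sup>2 = x\<^sup>2 + y\<^sup>2" by (simp add: r_def)
  have "(x / r)\<^sup>2 + (y / r)\<^sup>2 = 1"
    using r by (simp add: power_divide flip: add_divide_distrib r2)
  then obtain t where "0 \<le> t" "t < 2 * pi" "x / r = cos t" "y / r = sin t"
    by (rule sincos_total_2pi)
  then show ?thesis using r by (intro that[of r t]) (auto simp: field_simps)
qed

lemma polar_upper:
  fixes x y :: real
  assumes "0 < y"
  obtains r t where "0 < r" "0 < t" "t < pi" "x = r * cos t" "y = r * sin t"
proof -
  have "(x, y) \<noteq> (0, 0)" using assms by auto
  then obtain r t where rt: "0 < r" "0 \<le> t" "t < 2 * pi" "x = r * cos t" "y = r * sin t"
    by (rule polar)
  have s: "0 < sin t" using assms rt by (simp add: zero_less_mult_iff)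
  have "t < pi" using s rt(3) sin_le_zero[of t] by (cases "t < pi") auto
  moreover have "0 < t" using s rt(2) by (cases "t = 0") auto
  ultimately show ?thesis using that rt by blast
qed

locale adjacent =
  fixes p q :: "'n::{finite,wellorder}"
  assumes p_less_q: "p < q" and no_between: "k < q \<Longrightarrow> k \<le> p"
begin

abbreviation "R \<equiv> rotation p q"

definition sw :: "'n \<Rightarrow> 'n" where "sw i = (if i = p then q else if i = q then p else i)"

lemma p_neq_q [simp]: "p \<noteq> q" "q \<noteq> p"
  using p_less_q by auto

lemma sw_simps [simp]: "sw p = q" "sw q = p" "i \<noteq> p \<Longrightarrow> i \<noteq> q \<Longrightarrow> sw i = i" "sw (sw i) = i"
  by (auto simp: sw_def)

lemma sw_eq_iff [simp]: "sw i = sw j \<longleftrightarrow> i = j" "sw i = p \<longleftrightarrow> i = q" "sw i = q \<longleftrightarrow> i = p"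
  by (auto simp: sw_def)

lemma sw_comp [simp]: "sw \<circ> sw = id"
  by auto

lemma bij_sw: "bij sw"
  by (rule o_bij[of sw]) auto

text \<open>Nothing lies between \<open>p\<close> and \<open>q\<close>, so exchanging them can
  reverse no other pair.\<close>

lemma sw_less: "i < j \<Longrightarrow> (i, j) \<noteq> (p, q) \<Longrightarrow> sw i < sw j"
  using p_less_q no_between[of i] no_between[of j] by (auto simp: sw_def split: if_splits)
    (metis leD linorder_neqE)

lemma rotation_mult:
  fixes m :: "real^'n::{finite,wellorder}^'n::{finite,wellorder}"
  shows "(R t ** m) $ i $ j = (if i = p then cos t * m $ p $ j - sin t * m $ q $ j
     else if i = q then sin t * m $ p $ j + cos t * m $ q $ j else m $ i $ j)"
  by (simp add: matrix_matrix_mult_def rotation_def distrib_right sum.distrib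
      if_distrib[of "\<lambda>x. x * _"] cong: if_cong)

lemma mult_rotation:
  fixes m :: "real^'n::{finite,wellorder}^'n::{finite,wellorder}"
  shows "(m ** R t) $ i $ j = (if j = p then cos t * m $ i $ p + sin t * m $ i $ q
     else if j = q then cos t * m $ i $ q - sin t * m $ i $ p else m $ i $ j)"
proof -
  have "R t $ k $ j = (if k = j then if j = p \<or> j = q then cos t else 1 else 0)
     + (if k = p then if j = q then - sin t else 0 else 0)
     + (if k = q then if j = p then sin t else 0 else 0)" for k
    by (simp add: rotation_def)
  then show ?thesis
    by (simp add: matrix_matrix_mult_def distrib_left sum.distrib
      if_distrib[of "\<lambda>x. _ * x"] cong: if_cong)
qed

lemma rotation_add: "R s ** R t = R (s + t)"
  unfolding vec_eq_iff rotation_mult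
  by (auto simp: rotation_def cos_add sin_add)

lemma rotation_0 [simp]: "R 0 = mat 1"
  by (auto simp: vec_eq_iff rotation_def mat_def)

lemma rotation_transpose: "transpose (R t) = R (- t)"
  by (auto simp: vec_eq_iff rotation_def transpose_def)

lemma rotation_orthogonal: "orthogonal_matrix (R t)"
  by (simp add: orthogonal_matrix_def rotation_transpose rotation_add)

lemma rotation_cancel [simp]: "R t ** (R (- t) ** m) = m" "R (- t) ** (R t ** m) = m"
  "m ** R t ** R (- t) = m" "m ** R (- t) ** R t = m"
  by (simp_all add: matrix_mul_assoc rotation_add) (simp_all add: rotation_add flip: matrix_mul_assoc)

text \<open>Which multiple of the quarter turn occurs will depend on the matrix being rotated; for
  the permutation, and hence for the dimension, only its parity counts.\<close>

lemma rotation_quarter: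
  "signed_perm (R (of_int k * (pi / 2))) (if even k then id else sw)"
proof (cases "even k")
  case True
  then obtain m where k: "k = 2 * m" by auto
  have "sin (of_int k * (pi / 2)) = 0" "\<bar>cos (of_int k * (pi / 2))\<bar> = 1"
    by (simp_all add: k sin_npi_int cos_npi_int mult.commute)
  then show ?thesis using True by (auto simp: signed_perm_def rotation_def)
next
  case False
  then obtain m where k: "k = 2 * m + 1" by (auto elim: oddE)
  have eq: "of_int k * (pi / 2) = pi * of_int m + pi / 2" by (simp add: k field_simps)
  have "cos (of_int k * (pi / 2)) = 0" "\<bar>sin (of_int k * (pi / 2))\<bar> = 1"
    unfolding eq by (simp_all add: sin_add cos_add sin_npi_int cos_npi_int)
  then show ?thesis using False
    by (auto simp: signed_perm_def rotation_def bij_sw sw_def)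
qed

lemma rotation_half_pi: "signed_perm (R (pi / 2)) sw" "signed_perm (R (- (pi / 2))) sw"
  and rotation_pi: "signed_perm (R pi) id" "signed_perm (R (- pi)) id"
  using rotation_quarter[of 1] rotation_quarter[of "-1"] rotation_quarter[of 2] rotation_quarter[of "-2"]
  by simp_all

text \<open>The factors mix only the rows and the columns \<open>p\<close>, \<open>q\<close>, and no
  index lies between these. Hence \<open>(q, p)\<close> is the only position below the diagonal that
  can become nonzero, and only two diagonal entries change.\<close>

lemma rotation_Bplus_rotation:
  fixes b :: "real^'n::{finite,wellorder}^'n::{finite,wellorder}"
  assumes b: "b \<in> Bplus"
    and "(R s ** b ** R t) $ q $ p = 0" "0 < (R s ** b ** R t) $ p $ p" "0 < (R s ** b ** R t) $ q $ q"
  shows "R s ** b ** R t \<in> Bplus"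
proof (rule BplusI)
  fix i j :: 'n assume ji: "j < i"
  have *: "b $ k $ l = 0" if "l < k" for k l using Bplus_upper[OF b that] .
  have "p < i" if "j = q" using that ji p_less_q by auto
  moreover have "i \<noteq> p" if "j = q" using calculation that by auto
  moreover have "q < i" if "j = p" "i \<noteq> q"
    using that ji no_between[of i] by (metis leD linorder_neqE)
  moreover have "j < p" if "i = q" "j \<noteq> p"
    using that ji no_between[of j] by auto
  ultimately show "(R s ** b ** R t) $ i $ j = 0"
    using assms(2) ji p_less_q
    by (auto simp: mult_rotation rotation_mult * less_trans[OF _ p_less_q] less_trans[OF p_less_q])
next
  fix i
  show "0 < (R s ** b ** R t) $ i $ i"
    using assms(3,4) Bplus_pos[OF b, of i]
    by (cases "i = p \<or> i = q") (auto simp: mult_rotation rotation_mult)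
qed

text \<open>A decomposition of the \<open>p\<close>, \<open>q\<close> block of
  \<open>R s ** b\<close> into a triangular block times a rotation: \<open>(X, Y)\<close> is its
  lower row, and \<open>t\<close> is chosen so that \<open>R (- t)\<close> on the right turns this
  row onto the second axis. Then \<open>R s ** b = b' ** R t\<close>. The sign statement follows
  from \<open>X = sin s * b $ p $ p\<close>.\<close>

lemma rotation_double_coset:
  assumes g: "g \<in> Bruhat_double_coset w"
  obtains t where "R s ** g \<in> Bruhat_double_coset (R t ** w)" "0 < sin s \<Longrightarrow> 0 < sin t"
proof -
  obtain b c where bc: "b \<in> Bplus" "c \<in> Bplus" "g = b ** w ** c"
    using g by (rule Bruhat_double_cosetE)
  have b: "b $ q $ p = 0" "0 < b $ p $ p" "0 < b $ q $ q"
    using bc(1) p_less_q by (auto simp: Bplus_upper Bplus_pos)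
  define X where "X = sin s * b $ p $ p"
  define Y where "Y = sin s * b $ p $ q + cos s * b $ q $ q"
  have "(Y, X) \<noteq> (0, 0)"
  proof
    assume "(Y, X) = (0, 0)"
    then have "sin s = 0" "cos s = 0" using b by (auto simp: X_def Y_def)
    then show False using sin_cos_squared_add[of s] by simp
  qed
  then obtain r t where rt: "0 < r" "Y = r * cos t" "X = r * sin t" by (rule polar)
  define b' where "b' = R s ** b ** R (- t)"
  have "b' $ q $ p = cos t * X - sin t * Y"
    by (simp add: b'_def mult_rotation rotation_mult X_def Y_def b)
  then have 1: "b' $ q $ p = 0" by (simp add: rt)
  have "b' $ q $ q = cos t * Y + sin t * X"
    by (simp add: b'_def mult_rotation rotation_mult X_def Y_def b)
  also have "\<dots> = r" unfolding rt using sin_cos_squared_add[of t] by algebra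
  finally have 2: "b' $ q $ q = r" .
  \<comment> \<open>Rotations have determinant 1, so the \<open>p\<close>, \<open>q\<close> blocks
    of \<open>b\<close> and \<open>b'\<close> have equal determinants, and the lower row of the
    latter is \<open>(0, r)\<close>.\<close>
  have "r * b' $ p $ p = (r * cos t) * (cos s * b $ p $ p) - (r * sin t) * (cos s * b $ p $ q - sin s * b $ q $ q)"
    by (simp add: b'_def mult_rotation rotation_mult b algebra_simps)
  also have "\<dots> = b $ p $ p * b $ q $ q"
    unfolding rt(2,3)[symmetric] X_def Y_def using sin_cos_squared_add[of s] by algebra
  finally have "0 < r * b' $ p $ p" using b by simp
  then have 3: "0 < b' $ p $ p" using rt(1) by (simp add: zero_less_mult_iff)
  have b': "b' \<in> Bplus"
    unfolding b'_def using 1 2 3 rt(1) by (intro rotation_Bplus_rotation[OF bc(1)]) (auto simp: b'_def)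
  have "R s ** g = b' ** (R t ** w) ** c"
    by (simp add: b'_def bc matrix_mul_assoc)
  then have "R s ** g \<in> Bruhat_double_coset (R t ** w)"
    using Bruhat_double_cosetI[OF b' bc(2)] by simp
  moreover have "0 < sin t" if "0 < sin s"
    using that b(2) rt(1,3) by (simp add: X_def zero_less_mult_iff) (metis mult_pos_pos zero_less_mult_iff less_asym)
  ultimately show ?thesis using that by blast
qed

text \<open>The Bruhat decomposition of a 2 by 2 rotation with positive sine:
  \<open>R t = b ** R (pi / 2) ** U x\<close> with \<open>U x\<close> unipotent. The hypothesis
  \<open>a < c\<close> says that \<open>U x\<close> stays upper triangular when it is moved across
  \<open>w\<close>, where the right factor of the coset absorbs it.\<close>

lemma rotation_ascent_signed_perm:
  assumes w: "signed_perm w \<sigma>" and ac: "\<sigma> a = p" "\<sigma> c = q" "a < c" and t: "0 < sin t"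
  shows "R t ** w \<in> Bruhat_double_coset (R (pi / 2) ** w)"
proof -
  define U :: "real \<Rightarrow> real^'n::{finite,wellorder}^'n::{finite,wellorder}" where
    "U x = (\<chi> i j. (if j = i then 1 else 0) + (if j = q then if i = p then x else 0 else 0))" for x
  have UB: "U x \<in> Bplus" for x
    using p_less_q by (intro BplusI) (auto simp: U_def)
  have Um: "(U x ** m) $ i $ j = m $ i $ j + (if i = p then x * m $ q $ j else 0)" for x m i j
    by (simp add: matrix_matrix_mult_def U_def distrib_right sum.distrib
      if_distrib[of "\<lambda>x. x * _"] cong: if_cong)
  have UU: "U (- x) ** (U x ** m) = m" for x m
    by (auto simp: vec_eq_iff Um)
  \<comment> \<open>The cotangent is the value for which the entry \<open>(q, p)\<close> of
    \<open>b\<close> vanishes.\<close>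
  define x where "x = cos t / sin t"
  define b where "b = R t ** U (- x) ** R (- (pi / 2))"
  have "0 < x * cos t + sin t"
  proof -
    have "sin t * (x * cos t + sin t) = (cos t)\<^sup>2 + (sin t)\<^sup>2"
      using t by (simp add: x_def field_simps power2_eq_square)
    then have "0 < sin t * (x * cos t + sin t)" by simp
    then show ?thesis using t by (simp add: zero_less_mult_iff)
  qed
  then have b: "b \<in> Bplus"
    unfolding b_def using t
    by (intro rotation_Bplus_rotation UB) (auto simp: mult_rotation rotation_mult U_def x_def algebra_simps)
  \<comment> \<open>\<open>U x\<close> after the passage across \<open>w\<close>: position
    \<open>(p, q)\<close> becomes \<open>(a, c)\<close>, and the two entries of \<open>w\<close>
    supply the sign.\<close>
  define u' where "u' = (\<chi> i j. (if i = j then 1 else 0) + (if i = a \<and> j = c then x * w $ p $ a * w $ q $ c else 0))"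
  have u': "u' \<in> Bplus"
    using ac by (intro BplusI) (auto simp: u'_def)
  have wu: "U x ** w = w ** u'"
    unfolding vec_eq_iff
  proof (intro allI)
    fix k j
    obtain i where k: "k = \<sigma> i" using signed_permD(1)[OF w] by (meson bij_pointE)
    have sq: "w $ p $ a * w $ p $ a = 1"
      using signed_permD(2)[OF w, of a] ac by (metis abs_mult_self_eq mult_1)
    show "(U x ** w) $ k $ j = (w ** u') $ k $ j"
      unfolding k Um signed_perm_mult_left[OF w]
      using signed_permD(3,4)[OF w] ac sq
      by (auto simp: u'_def algebra_simps)
  qed
  have "b ** (R (pi / 2) ** w) ** u' = R t ** (U (- x) ** (U x ** w))"
    unfolding wu b_def by (simp add: matrix_mul_assoc)
  also have "\<dots> = R t ** w" by (simp add: UU)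
  finally show ?thesis using Bruhat_double_cosetI[OF b u'] by metis
qed

lemma rotation_ascent:
  assumes "g \<in> Bruhat_double_coset w" "signed_perm w \<sigma>" "\<sigma> a = p" "\<sigma> c = q" "a < c" "0 < sin t"
  shows "R t ** g \<in> Bruhat_double_coset (R (pi / 2) ** w)"
  using rotation_double_coset[OF assms(1), of t] rotation_ascent_signed_perm[OF assms(2-5)] assms(6)
    Bruhat_double_coset_trans by metis

text \<open>The ascent lemma treats a positive sine and rows \<open>p\<close>, \<open>q\<close> met
  in increasing order. A half turn changes the sign of the sine, a preliminary quarter turn reverses
  the order, and an angle of zero sine is already a multiple of the half turn.\<close>

lemma rotation_left:
  assumes g: "g \<in> Bruhat_double_coset w" and w: "signed_perm w \<sigma>"
  obtains k :: int where "R s ** g \<in> Bruhat_double_coset (R (of_int k * (pi / 2)) ** w)"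
proof -
  have asc: "\<exists>k::int. R t ** v \<in> Bruhat_double_coset (R (of_int k * (pi / 2)) ** v)"
    if v: "signed_perm v \<tau>" and ac: "\<tau> a = p" "\<tau> c = q" "a < c" for v \<tau> a c t
  proof -
    consider "0 < sin t" | "sin t = 0" | "sin t < 0" by linarith
    then show ?thesis
    proof cases
      case 1
      then show ?thesis using rotation_ascent_signed_perm[OF v ac] by (intro exI[of _ 1]) simp
    next
      case 2
      then obtain m :: int where "t = of_int m * pi" by (auto simp: sin_zero_iff_int2)
      then show ?thesis using Bruhat_double_coset_self by (intro exI[of _ "2 * m"]) simp
    next
      case 3
      have v': "signed_perm (R (- pi) ** v) \<tau>"
        using signed_perm_mult[OF rotation_pi(2) v] by simp
      have "R (t + pi) ** (R (- pi) ** v) \<in> Bruhat_double_coset (R (pi / 2) ** (R (- pi) ** v))"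
        using 3 by (intro rotation_ascent_signed_perm[OF v' ac]) simp
      then have "R t ** v \<in> Bruhat_double_coset (R (pi / 2 - pi) ** v)"
        by (simp add: matrix_mul_assoc rotation_add)
      moreover have "pi / 2 - pi = of_int (-1) * (pi / 2)" by simp
      ultimately show ?thesis by metis
    qed
  qed
  obtain t where t: "R s ** g \<in> Bruhat_double_coset (R t ** w)"
    using rotation_double_coset[OF g] by metis
  obtain a c where ac: "\<sigma> a = p" "\<sigma> c = q" using signed_permD(1)[OF w] by (metis bij_pointE)
  have "\<exists>k::int. R t ** w \<in> Bruhat_double_coset (R (of_int k * (pi / 2)) ** w)"
  proof (cases "a < c")
    case True
    then show ?thesis using asc[OF w ac] by blast
  next
    case False
    then have ca: "c < a" using ac by (metis linorder_neqE p_neq_q(1))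
    have w': "signed_perm (R (pi / 2) ** w) (sw \<circ> \<sigma>)"
      using signed_perm_mult[OF rotation_half_pi(1) w] .
    obtain k :: int where "R (t - pi / 2) ** (R (pi / 2) ** w) \<in>
        Bruhat_double_coset (R (of_int k * (pi / 2)) ** (R (pi / 2) ** w))"
      using asc[OF w' _ _ ca] ac by auto
    then have "R t ** w \<in> Bruhat_double_coset (R (of_int k * (pi / 2) + pi / 2) ** w)"
      by (simp add: matrix_mul_assoc rotation_add)
    moreover have "of_int k * (pi / 2) + pi / 2 = of_int (k + 1) * (pi / 2)"
      by (simp add: field_simps)
    ultimately show ?thesis by metis
  qed
  then show ?thesis using t that Bruhat_double_coset_trans by blast
qed

lemma rotation_right:
  assumes g: "g \<in> Bruhat_double_coset w" and w: "signed_perm w \<sigma>" and o: "orthogonal_matrix g"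
  obtains k :: int where "g ** R s \<in> Bruhat_double_coset (w ** R (of_int k * (pi / 2)))"
proof -
  have "transpose g \<in> Bruhat_double_coset (transpose w)"
    using Bruhat_double_coset_transpose g o signed_perm_orthogonal[OF w] by blast
  then obtain k :: int where
    k: "R (- s) ** transpose g \<in> Bruhat_double_coset (R (of_int k * (pi / 2)) ** transpose w)"
    using rotation_left[OF _ signed_perm_transpose[OF w]] by blast
  have "transpose (R (- s) ** transpose g) \<in> Bruhat_double_coset (transpose (R (of_int k * (pi / 2)) ** transpose w))"
    using k o signed_perm_orthogonal[OF w]
    by (intro Bruhat_double_coset_transpose orthogonal_matrix_mul rotation_orthogonal)
       (auto simp: orthogonal_matrix_transpose_iff)
  then have "g ** R s \<in> Bruhat_double_coset (w ** R (of_int (- k) * (pi / 2)))"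
    by (simp add: matrix_transpose_mul rotation_transpose)
  then show ?thesis using that by blast
qed

text \<open>The angle is that of the column \<open>(b $ p $ q, b $ q $ q)\<close>, strictly between
  0 and \<open>pi\<close> because \<open>b $ q $ q\<close> is positive. \<open>R (- t)\<close> turns
  this column onto the first axis, and \<open>R (pi / 2)\<close> on the right moves it into column
  \<open>p\<close>.\<close>

lemma rotation_reduce:
  assumes g: "g \<in> Bruhat_double_coset w"
  obtains t where "0 < t" "t < pi" "R (- t) ** g \<in> Bruhat_double_coset (R (- (pi / 2)) ** w)"
proof -
  obtain b c where bc: "b \<in> Bplus" "c \<in> Bplus" "g = b ** w ** c"
    using g by (rule Bruhat_double_cosetE)
  have b: "b $ q $ p = 0" "0 < b $ p $ p" "0 < b $ q $ q"
    using bc(1) p_less_q by (auto simp: Bplus_upper Bplus_pos)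
  obtain r t where rt: "0 < r" "0 < t" "t < pi" "b $ p $ q = r * cos t" "b $ q $ q = r * sin t"
    using b(3) by (rule polar_upper)
  define b' where "b' = R (- t) ** b ** R (pi / 2)"
  have "b' $ p $ p = cos t * (r * cos t) + sin t * (r * sin t)"
    by (simp add: b'_def mult_rotation rotation_mult b rt)
  also have "\<dots> = r" using sin_cos_squared_add[of t] by algebra
  finally have 1: "b' $ p $ p = r" .
  have 2: "b' $ q $ p = 0" "b' $ q $ q = sin t * b $ p $ p"
    by (simp_all add: b'_def mult_rotation rotation_mult b rt algebra_simps)
  have b': "b' \<in> Bplus"
    unfolding b'_def using 1 2 rt b sin_gt_zero[of t]
    by (intro rotation_Bplus_rotation[OF bc(1)]) (auto simp: b'_def)
  have "R (- t) ** g = b' ** (R (- (pi / 2)) ** w) ** c"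
    by (simp add: b'_def bc matrix_mul_assoc)
  then show ?thesis using Bruhat_double_cosetI[OF b' bc(2)] that rt by metis
qed

lemma rotation_pi_left:
  assumes "g \<in> Bruhat_double_coset w"
  shows "R pi ** g \<in> Bruhat_double_coset (R pi ** w)"
proof -
  obtain b c where bc: "b \<in> Bplus" "c \<in> Bplus" "g = b ** w ** c"
    using assms by (rule Bruhat_double_cosetE)
  have b: "b $ q $ p = 0" "0 < b $ p $ p" "0 < b $ q $ q"
    using bc(1) p_less_q by (auto simp: Bplus_upper Bplus_pos)
  have b': "R pi ** b ** R (- pi) \<in> Bplus"
    using b by (intro rotation_Bplus_rotation[OF bc(1)]) (auto simp: mult_rotation rotation_mult)
  have "R pi ** g = (R pi ** b ** R (- pi)) ** (R pi ** w) ** c"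
    by (simp add: bc matrix_mul_assoc)
  then show ?thesis using Bruhat_double_cosetI[OF b' bc(2)] by metis
qed

end

section \<open>The dimension of an involution\<close>

definition inversions :: "('n::linorder \<Rightarrow> 'n) \<Rightarrow> ('n \<times> 'n) set" where
  "inversions \<sigma> = {(i, j). i < j \<and> \<sigma> j < \<sigma> i}"

text \<open>For an involution the numerator is divisible by 4: the dimension is half the sum of the
  numbers of inversions and of 2-cycles.\<close>

definition involution_dim :: "('n::{finite,linorder} \<Rightarrow> 'n) \<Rightarrow> nat" where
  "involution_dim \<sigma> = (2 * card (inversions \<sigma>) + card {i. \<sigma> i \<noteq> i}) div 4"

lemma involution_dim_id: "involution_dim id = 0"
proof -
  have "inversions (id :: 'a \<Rightarrow> 'a) = {}" by (auto simp: inversions_def)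
  then show ?thesis by (simp add: involution_dim_def)
qed

section \<open>Change of dimension under an adjacent transposition\<close>

context adjacent
begin

lemma card_inversions_right:
  assumes "\<sigma> p < \<sigma> q"
  shows "card (inversions (\<sigma> \<circ> sw)) = Suc (card (inversions \<sigma>))"
proof -
  have eq: "inversions (\<sigma> \<circ> sw) = insert (p, q) (map_prod sw sw ` inversions \<sigma>)"
  proof (intro set_eqI iffI; clarify)
    fix i j assume ij: "(i, j) \<in> inversions (\<sigma> \<circ> sw)" "(i, j) \<notin> map_prod sw sw ` inversions \<sigma>"
    show "i = p \<and> j = q"
    proof (rule ccontr)
      assume "\<not> ?thesis"
      then have "sw i < sw j" using ij(1) by (intro sw_less) (auto simp: inversions_def)
      then have "(sw i, sw j) \<in> inversions \<sigma>" using ij(1) by (auto simp: inversions_def)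
      then have "map_prod sw sw (sw i, sw j) \<in> map_prod sw sw ` inversions \<sigma>" by (rule imageI)
      then show False using ij(2) by simp
    qed
  next
    fix i j assume "(i, j) \<in> insert (p, q) (map_prod sw sw ` inversions \<sigma>)"
    then show "(i, j) \<in> inversions (\<sigma> \<circ> sw)"
      using assms p_less_q by (auto simp: inversions_def intro!: sw_less)
  qed
  have "(p, q) \<notin> map_prod sw sw ` inversions \<sigma>"
    using p_less_q by (auto simp: inversions_def sw_def split: if_splits)
  moreover have "inj (map_prod sw sw)" using bij_sw by (intro prod.inj_map) (auto simp: bij_is_inj)
  ultimately show ?thesis
    unfolding eq by (simp add: card_image inj_on_subset)
qed

lemma card_inversions_left:
  assumes "inj \<sigma>" "\<sigma> a = p" "\<sigma> c = q" "a < c"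
  shows "card (inversions (sw \<circ> \<sigma>)) = Suc (card (inversions \<sigma>))"
proof -
  have inj: "\<sigma> i = p \<longleftrightarrow> i = a" "\<sigma> i = q \<longleftrightarrow> i = c" for i
    using assms by (auto dest: injD)
  have "sw (\<sigma> j) < sw (\<sigma> i) \<longleftrightarrow> \<sigma> j < \<sigma> i \<or> (i = a \<and> j = c)" if "i < j" for i j
  proof
    assume "sw (\<sigma> j) < sw (\<sigma> i)"
    then show "\<sigma> j < \<sigma> i \<or> (i = a \<and> j = c)"
      using sw_less[of "sw (\<sigma> j)" "sw (\<sigma> i)"] inj by auto
  next
    assume "\<sigma> j < \<sigma> i \<or> (i = a \<and> j = c)"
    then show "sw (\<sigma> j) < sw (\<sigma> i)"
    proof
      assume "\<sigma> j < \<sigma> i"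
      moreover have "(\<sigma> j, \<sigma> i) \<noteq> (p, q)" using inj that assms(4) by auto
      ultimately show ?thesis by (rule sw_less)
    qed (simp add: assms(2,3) p_less_q)
  qed
  then have "inversions (sw \<circ> \<sigma>) = insert (a, c) (inversions \<sigma>)"
    using assms(4) by (auto simp: inversions_def)
  moreover have "(a, c) \<notin> inversions \<sigma>" using assms p_less_q by (auto simp: inversions_def)
  ultimately show ?thesis by simp
qed

text \<open>Each of the two factors \<open>sw\<close> creates one inversion: after the first, the
  positions of the values \<open>p\<close>, \<open>q\<close> are still in increasing order, because
  \<sigma> does not fix both. The number of moved points is unchanged, so the numerator grows by
  4.\<close>

lemma involution_dim_conj:
  assumes inv: "\<sigma> \<circ> \<sigma> = id" and "\<sigma> p < \<sigma> q" and "\<not> (\<sigma> p = p \<and> \<sigma> q = q)"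
  shows "involution_dim (sw \<circ> \<sigma> \<circ> sw) = Suc (involution_dim \<sigma>)"
proof -
  have ss: "\<sigma> (\<sigma> i) = i" for i using inv by (metis comp_apply id_apply)
  have "inj (\<sigma> \<circ> sw)" using inv bij_sw by (metis bij_is_inj inj_compose o_bij)
  then have "card (inversions (sw \<circ> (\<sigma> \<circ> sw))) = Suc (card (inversions (\<sigma> \<circ> sw)))"
    by (rule card_inversions_left[where a = "sw (\<sigma> p)" and c = "sw (\<sigma> q)"])
       (use assms ss in \<open>auto intro!: sw_less\<close>)
  moreover have "{i. (sw \<circ> \<sigma> \<circ> sw) i \<noteq> i} = sw ` {i. \<sigma> i \<noteq> i}"
  proof (intro set_eqI iffI)
    fix i assume "i \<in> {i. (sw \<circ> \<sigma> \<circ> sw) i \<noteq> i}"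
    then have "sw i \<in> {i. \<sigma> i \<noteq> i}" by auto
    then have "sw (sw i) \<in> sw ` {i. \<sigma> i \<noteq> i}" by (rule imageI)
    then show "i \<in> sw ` {i. \<sigma> i \<noteq> i}" by simp
  qed auto
  then have "card {i. (sw \<circ> \<sigma> \<circ> sw) i \<noteq> i} = card {i. \<sigma> i \<noteq> i}"
    using card_image[OF inj_on_subset[OF bij_is_inj[OF bij_sw] subset_UNIV]] by simp
  ultimately show ?thesis
    using card_inversions_right[OF assms(2)] by (simp add: involution_dim_def comp_assoc)
qed

text \<open>One new inversion and two new moved points: again the numerator grows by 4.\<close>

lemma involution_dim_fixed:
  assumes "inj \<sigma>" "\<sigma> p = p" "\<sigma> q = q"
  shows "involution_dim (sw \<circ> \<sigma>) = Suc (involution_dim \<sigma>)"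
proof -
  have "card (inversions (sw \<circ> \<sigma>)) = Suc (card (inversions \<sigma>))"
    using assms p_less_q by (intro card_inversions_left)
  moreover have "{i. (sw \<circ> \<sigma>) i \<noteq> i} = insert p (insert q {i. \<sigma> i \<noteq> i})"
  proof -
    have "\<sigma> i = p \<longleftrightarrow> i = p" "\<sigma> i = q \<longleftrightarrow> i = q" for i
      using assms by (metis injD)+
    then show ?thesis by (auto simp: sw_def)
  qed
  ultimately show ?thesis using assms by (simp add: involution_dim_def)
qed

text \<open>If \<sigma> preserves \<open>{p, q}\<close>, it commutes with \<open>sw\<close>,
  conjugation does nothing, and a one-sided product only creates or removes the 2-cycle of
  \<open>p\<close> and \<open>q\<close>. Otherwise \<sigma> and \<open>sw\<close> do not commute, so
  no one-sided product is an involution, and conjugation changes the dimension by one, up or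
  down.\<close>

lemma involution_dim_step_le:
  assumes inv: "\<sigma> \<circ> \<sigma> = id" and inv': "\<tau> \<circ> \<tau> = id"
    and \<tau>: "\<tau> \<in> {\<sigma>, sw \<circ> \<sigma>, \<sigma> \<circ> sw, sw \<circ> \<sigma> \<circ> sw}"
  shows "involution_dim \<tau> \<le> Suc (involution_dim \<sigma>)"
proof -
  have ss: "\<sigma> (\<sigma> i) = i" for i using inv by (metis comp_apply id_apply)
  have tt: "\<tau> (\<tau> i) = i" for i using inv' by (metis comp_apply id_apply)
  have inj: "inj \<sigma>" using ss by (metis injI)
  have seq: "\<sigma> i = \<sigma> j \<longleftrightarrow> i = j" for i j using inj by (auto dest: injD)
  consider (same) "\<sigma> p = p" "\<sigma> q = q" | (swap) "\<sigma> p = q" "\<sigma> q = p"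
    | (out) "\<not> (\<sigma> p \<in> {p, q} \<and> \<sigma> q \<in> {p, q})"
    using seq[of p q] p_neq_q by (metis insertE singletonD)
  then show ?thesis
  proof cases
    case same
    have "sw (\<sigma> (sw i)) = \<sigma> i" for i
      using same seq[of i p] seq[of i q] by (auto simp: sw_def)
    then have c: "sw \<circ> \<sigma> \<circ> sw = \<sigma>" "\<sigma> \<circ> sw = sw \<circ> \<sigma>"
      by (auto simp: fun_eq_iff) (metis sw_simps(4))
    show ?thesis using \<tau> involution_dim_fixed[OF inj same] by (auto simp: c)
  next
    case swap
    have "sw (\<sigma> (sw i)) = \<sigma> i" for i
      using swap seq[of i p] seq[of i q] by (auto simp: sw_def)
    then have c: "sw \<circ> \<sigma> \<circ> sw = \<sigma>" "\<sigma> \<circ> sw = sw \<circ> \<sigma>"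
      by (auto simp: fun_eq_iff) (metis sw_simps(4))
    have "involution_dim (sw \<circ> (sw \<circ> \<sigma>)) = Suc (involution_dim (sw \<circ> \<sigma>))"
      using swap inj_compose[OF bij_is_inj[OF bij_sw] inj] by (intro involution_dim_fixed) auto
    then show ?thesis using \<tau> by (auto simp: c simp flip: comp_assoc)
  next
    case out
    have nc: "\<sigma> (sw p) \<noteq> sw (\<sigma> p)"
    proof
      assume "\<sigma> (sw p) = sw (\<sigma> p)"
      then have "\<sigma> q = sw (\<sigma> p)" by simp
      moreover have "\<sigma> p \<noteq> \<sigma> q" by (simp add: seq)
      ultimately have "\<sigma> p \<in> {p, q}" by (metis insertCI sw_simps(3))
      then show False using out \<open>\<sigma> q = sw (\<sigma> p)\<close> by (metis insertCI insertE singletonD sw_simps(1,2))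
    qed
    consider "\<tau> = \<sigma>" | "\<tau> = sw \<circ> \<sigma>" | "\<tau> = \<sigma> \<circ> sw" | "\<tau> = sw \<circ> \<sigma> \<circ> sw" using \<tau> by auto
    then show ?thesis
    proof cases
      case 2
      then have "sw (\<sigma> (sw p)) = \<sigma> p" using tt[of "\<sigma> p"] ss by auto
      then show ?thesis using nc by (metis sw_simps(4))
    next
      case 3
      then have "\<sigma> (sw (\<sigma> (sw p))) = p" using tt[of p] by auto
      then show ?thesis using nc ss by (metis sw_simps(4))
    next
      case 4
      show ?thesis
      proof (cases "\<sigma> p < \<sigma> q")
        case True
        then show ?thesis using involution_dim_conj[OF inv] out 4 by auto
      next
        case False
        then have "\<sigma> q < \<sigma> p" using seq[of p q] by auto
        then have "\<tau> p < \<tau> q" unfolding 4 using out by (auto intro!: sw_less)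
        then have "involution_dim (sw \<circ> \<tau> \<circ> sw) = Suc (involution_dim \<tau>)"
          using out by (intro involution_dim_conj[OF inv']) (auto simp: 4)
        moreover have "sw \<circ> \<tau> \<circ> sw = \<sigma>" by (auto simp: 4)
        ultimately show ?thesis by simp
      qed
    qed simp
  qed
qed

end

section \<open>Cells of orthogonal involutions\<close>

definition orthogonal_involutions :: "(real^'n^'n) set" where
  "orthogonal_involutions = {g. orthogonal_matrix g \<and> g ** g = mat 1}"

text \<open>The trace is not mentioned, so that the induction can ignore \<open>k\<close>; it turns
  out to be constant on each of these sets.\<close>

definition involution_cell ::
    "real^'n::{finite,wellorder}^'n::{finite,wellorder} \<Rightarrow> (real^'n::{finite,wellorder}^'n::{finite,wellorder}) set" where
  "involution_cell w = orthogonal_involutions \<inter> Bruhat_double_coset w"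

definition in_cell_below :: "nat \<Rightarrow> real^'n::{finite,wellorder}^'n::{finite,wellorder} \<Rightarrow> bool" where
  "in_cell_below d g \<longleftrightarrow>
     (\<exists>w \<sigma>. signed_perm w \<sigma> \<and> g \<in> involution_cell w \<and> involution_dim \<sigma> < d)"

lemma orthogonal_involutions_transpose:
  assumes "g \<in> orthogonal_involutions" shows "transpose g = g"
proof -
  have "transpose g = transpose g ** (g ** g)" using assms by (simp add: orthogonal_involutions_def)
  also have "\<dots> = (transpose g ** g) ** g" by (simp only: matrix_mul_assoc)
  also have "\<dots> = g"
    using assms by (simp add: orthogonal_involutions_def orthogonal_matrix_def)
  finally show ?thesis .
qed

text \<open>The symmetric matrix \<open>g\<close> lies in the cosets of both \<open>w\<close> and
  \<open>transpose w\<close>, and the representative is unique.\<close>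

lemma involution_cell_signed_perm:
  assumes g: "g \<in> involution_cell w" and w: "signed_perm w \<sigma>"
  shows "transpose w = w" "w ** w = mat 1" "\<sigma> \<circ> \<sigma> = id" "w \<in> orthogonal_involutions"
proof -
  have "transpose g = g"
    using g by (auto simp: involution_cell_def orthogonal_involutions_transpose)
  moreover have "transpose g \<in> Bruhat_double_coset (transpose w)"
    using g signed_perm_orthogonal[OF w]
    by (intro Bruhat_double_coset_transpose) (auto simp: involution_cell_def orthogonal_involutions_def)
  ultimately show 1: "transpose w = w"
    using g Bruhat_unique[OF signed_perm_transpose[OF w] w] by (auto simp: involution_cell_def)
  then show 2: "w ** w = mat 1"
    using signed_perm_orthogonal[OF w] by (simp add: orthogonal_matrix_def)
  show "\<sigma> \<circ> \<sigma> = id"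
    using signed_perm_mult[OF w w] signed_perm_mat_1 unfolding 2 by (rule signed_perm_unique)
  show "w \<in> orthogonal_involutions"
    using 2 signed_perm_orthogonal[OF w] by (simp add: orthogonal_involutions_def)
qed

lemma signed_involution_cell:
  assumes "signed_perm w \<sigma>" "w ** w = mat 1"
  shows "w \<in> involution_cell w"
  using assms signed_perm_orthogonal[OF assms(1)] Bruhat_double_coset_self
  by (auto simp: involution_cell_def orthogonal_involutions_def)

lemma trace_conj_orthogonal:
  fixes g h :: "real^'n^'n"
  assumes "orthogonal_matrix h"
  shows "trace (h ** g ** transpose h) = trace g"
  using assms trace_mul_sym[of "h ** g" "transpose h"]
  by (simp add: matrix_mul_assoc orthogonal_matrix_def)

text \<open>The corner lemma makes the columns up to \<open>m\<close> upper triangular. By induction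
  on \<open>j\<close>, column \<open>j\<close> then has only its diagonal entry, of absolute value 1
  since columns are unit vectors, and the unit length of row \<open>j\<close> clears the rest of
  that row. The sign comes from the corner lemma again.\<close>

lemma orthogonal_fixed_columns:
  assumes g: "g \<in> Bruhat_double_coset w" "orthogonal_matrix g" and w: "signed_perm w \<sigma>"
    and fixed: "\<And>j. j \<le> m \<Longrightarrow> \<sigma> j = j" and "j \<le> m"
  shows "g $ i $ j = w $ i $ j" "g $ j $ i = w $ j $ i"
proof -
  have wz: "w $ i $ j = 0" if "j \<le> m" "i \<noteq> j" for i j
    using that fixed[OF that(1)] signed_permD(3)[OF w] by auto
  have upper: "g $ i $ j = 0" if ij: "j < i" "j \<le> m" for i j
  proof -
    obtain r where "g $ i $ j = r * w $ i $ j"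
      by (rule Bruhat_double_coset_corner[OF g(1), of i j]) (use ij in \<open>auto intro!: wz\<close>)
    then show ?thesis using wz[of j i] ij by simp
  qed
  have col: "(\<Sum>k\<in>UNIV. g $ k $ j * g $ k $ j) = 1" for j
    using g(2) by (simp add: orthogonal_matrix_def vec_eq_iff matrix_matrix_mult_def transpose_def mat_def)
  have row: "(\<Sum>k\<in>UNIV. g $ j $ k * g $ j $ k) = 1" for j
    using g(2) by (simp add: orthogonal_matrix_def vec_eq_iff matrix_matrix_mult_def transpose_def mat_def)
  have off: "\<forall>i. i \<noteq> j \<longrightarrow> g $ i $ j = 0 \<and> g $ j $ i = 0" if "j \<le> m" for j
    using that
  proof (induction j rule: less_induct)
    case (less j)
    have c0: "g $ i $ j = 0" if "i \<noteq> j" for i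
    proof (cases "i < j")
      case True
      then show ?thesis using less by (metis leD less_le_trans less_imp_le)
    next
      case False
      then show ?thesis using upper[of j i] less that by auto
    qed
    have "(\<Sum>k\<in>UNIV. g $ k $ j * g $ k $ j) = (\<Sum>k\<in>{j}. g $ k $ j * g $ k $ j)"
      using c0 by (intro sum.mono_neutral_right) auto
    then have gj: "g $ j $ j * g $ j $ j = 1" using col[of j] by simp
    have "(\<Sum>k\<in>UNIV. g $ j $ k * g $ j $ k) = g $ j $ j * g $ j $ j + (\<Sum>k\<in>UNIV - {j}. g $ j $ k * g $ j $ k)"
      by (simp add: sum.remove)
    then have "(\<Sum>k\<in>UNIV - {j}. g $ j $ k * g $ j $ k) = 0" using gj row[of j] by simp
    then have "\<forall>k\<in>UNIV - {j}. g $ j $ k * g $ j $ k = 0"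
      by (subst (asm) sum_nonneg_eq_0_iff) auto
    then show ?case using c0 by auto
  qed
  have diag: "g $ j $ j = w $ j $ j" if jm: "j \<le> m" for j
  proof -
    have "(\<Sum>k\<in>UNIV. g $ k $ j * g $ k $ j) = (\<Sum>k\<in>{j}. g $ k $ j * g $ k $ j)"
      using off[OF that] by (intro sum.mono_neutral_right) auto
    then have "g $ j $ j * g $ j $ j = 1" using col[of j] by simp
    then have gj: "\<bar>g $ j $ j\<bar> = 1" by (metis abs_1 abs_mult_self_eq abs_square_eq_1 power2_eq_square)
    obtain r where r: "0 < r" "g $ j $ j = r * w $ j $ j"
      by (rule Bruhat_double_coset_corner[OF g(1), of j j])
        (use jm in \<open>auto intro!: wz intro: order_trans\<close>)
    have wj: "\<bar>w $ j $ j\<bar> = 1" using signed_permD(2)[OF w, of j] fixed[OF that] by simp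
    have "r = 1" using gj wj r by (simp add: abs_mult)
    then show ?thesis using r by simp
  qed
  have off': "w $ j $ i = 0" if "i \<noteq> j"
    using that signed_permD(3,4)[OF w, of j] fixed[OF \<open>j \<le> m\<close>] by metis
  show "g $ i $ j = w $ i $ j" "g $ j $ i = w $ j $ i"
    using diag[OF \<open>j \<le> m\<close>] off[OF \<open>j \<le> m\<close>] wz[OF \<open>j \<le> m\<close>, of i] off' by (cases "i = j"; auto)+
qed

lemma orthogonal_fixed_columns_closure:
  assumes g: "g \<in> closure (involution_cell w)" and w: "signed_perm w \<sigma>"
    and fixed: "\<And>j. j \<le> m \<Longrightarrow> \<sigma> j = j" and "j \<le> m"
  shows "g $ i $ j = w $ i $ j" "g $ j $ i = w $ j $ i"
proof -
  let ?S = "{g. g $ i $ j = w $ i $ j \<and> g $ j $ i = w $ j $ i}"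
  have "closed ?S"
    by (intro closed_Collect_conj closed_Collect_eq continuous_intros)
  moreover have "involution_cell w \<subseteq> ?S"
    using orthogonal_fixed_columns[OF _ _ w fixed \<open>j \<le> m\<close>]
    by (auto simp: involution_cell_def orthogonal_involutions_def)
  ultimately have "g \<in> ?S" using g closure_minimal by blast
  then show "g $ i $ j = w $ i $ j" "g $ j $ i = w $ j $ i" by auto
qed

section \<open>Rotations and cells of smaller dimension\<close>

context adjacent
begin

lemma rotation_conj_involution:
  "g \<in> orthogonal_involutions \<Longrightarrow> R t ** g ** R (- t) \<in> orthogonal_involutions"
proof -
  assume g: "g \<in> orthogonal_involutions"
  have "R t ** g ** R (- t) ** (R t ** g ** R (- t)) = R t ** (g ** g) ** R (- t)"
    by (simp add: matrix_mul_assoc)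
  also have "\<dots> = mat 1" using g by (simp add: orthogonal_involutions_def rotation_add)
  finally show ?thesis
    using g by (auto simp: orthogonal_involutions_def intro!: orthogonal_matrix_mul rotation_orthogonal)
qed

lemma trace_rotation_conj: "trace (R t ** g ** R (- t)) = trace g"
  using trace_conj_orthogonal[OF rotation_orthogonal, of t g] by (simp add: rotation_transpose)

lemma in_cell_belowI:
  assumes "signed_perm x \<sigma>" "g \<in> involution_cell x"
    "signed_perm y \<tau>" "h \<in> involution_cell y"
    "\<tau> \<in> {\<sigma>, sw \<circ> \<sigma>, \<sigma> \<circ> sw, sw \<circ> \<sigma> \<circ> sw}" "involution_dim \<sigma> < d"
  shows "in_cell_below (Suc d) h"
proof -
  have "involution_dim \<tau> \<le> Suc (involution_dim \<sigma>)"
    using assms involution_cell_signed_perm(3) by (intro involution_dim_step_le) blast+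
  then show ?thesis using assms unfolding in_cell_below_def by fastforce
qed

lemma in_cell_below_rotation_left:
  assumes "in_cell_below d g" "R t ** g \<in> orthogonal_involutions"
  shows "in_cell_below (Suc d) (R t ** g)"
proof -
  obtain x \<sigma> where x: "signed_perm x \<sigma>" "g \<in> involution_cell x" "involution_dim \<sigma> < d"
    using assms by (auto simp: in_cell_below_def)
  then obtain k :: int where k: "R t ** g \<in> Bruhat_double_coset (R (of_int k * (pi / 2)) ** x)"
    using rotation_left by (metis Int_iff involution_cell_def)
  show ?thesis
    using k assms(2)
    by (intro in_cell_belowI[OF x(1,2) signed_perm_mult[OF rotation_quarter[of k] x(1)]] x)
       (auto simp: involution_cell_def)
qed

text \<open>The quarter turns found on the left and on the right need not match. The dimension bound
  allows for this: it admits all four products with \<open>sw\<close>, provided the result is an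
  involution.\<close>

lemma in_cell_below_rotation_conj:
  assumes "in_cell_below d g"
  shows "in_cell_below (Suc d) (R t ** g ** R (- t))"
proof -
  obtain x \<sigma> where x: "signed_perm x \<sigma>" "g \<in> involution_cell x" "involution_dim \<sigma> < d"
    using assms by (auto simp: in_cell_below_def)
  then obtain k :: int where k: "R t ** g \<in> Bruhat_double_coset (R (of_int k * (pi / 2)) ** x)"
    using rotation_left by (metis Int_iff involution_cell_def)
  have kx: "signed_perm (R (of_int k * (pi / 2)) ** x) ((if even k then id else sw) \<circ> \<sigma>)"
    using signed_perm_mult[OF rotation_quarter x(1)] .
  have "orthogonal_matrix (R t ** g)"
    using x(2) by (auto simp: involution_cell_def orthogonal_involutions_def intro: orthogonal_matrix_mul rotation_orthogonal)
  then obtain l :: int where l: "R t ** g ** R (- t) \<in>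
      Bruhat_double_coset (R (of_int k * (pi / 2)) ** x ** R (of_int l * (pi / 2)))"
    using rotation_right[OF k kx] by blast
  show ?thesis
    using l x(2)
    by (intro in_cell_belowI[OF x(1,2) signed_perm_mult[OF kx rotation_quarter[of l]]] x)
       (auto simp: involution_cell_def intro: rotation_conj_involution)
qed

text \<open>\<open>R pi\<close> only changes signs, so the bound stays \<open>d\<close>. This serves
  the faces where the angle is \<open>pi\<close>.\<close>

lemma in_cell_below_rotation_pi_left:
  assumes "in_cell_below d g" "R pi ** g \<in> orthogonal_involutions"
  shows "in_cell_below d (R pi ** g)"
proof -
  obtain x \<sigma> where x: "signed_perm x \<sigma>" "g \<in> involution_cell x" "involution_dim \<sigma> < d"
    using assms by (auto simp: in_cell_below_def)
  have "signed_perm (R pi ** x) \<sigma>" using signed_perm_mult[OF rotation_pi(1) x(1)] by simp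
  then show ?thesis
    using x assms(2) rotation_pi_left[of g x] unfolding in_cell_below_def involution_cell_def by blast
qed

lemma in_cell_below_rotation_pi_conj:
  assumes "in_cell_below d g"
  shows "in_cell_below d (R pi ** g ** R (- pi))"
proof -
  obtain x \<sigma> where x: "signed_perm x \<sigma>" "g \<in> involution_cell x" "involution_dim \<sigma> < d"
    using assms by (auto simp: in_cell_below_def)
  have g: "transpose g = g" "transpose x = x" "orthogonal_matrix g" "orthogonal_matrix x"
    using x involution_cell_signed_perm(1)[OF x(2,1)] signed_perm_orthogonal[OF x(1)]
    by (auto simp: orthogonal_involutions_transpose involution_cell_def orthogonal_involutions_def)
  have "R pi ** g \<in> Bruhat_double_coset (R pi ** x)"
    using x rotation_pi_left by (auto simp: involution_cell_def)
  then have "transpose (R pi ** g) \<in> Bruhat_double_coset (transpose (R pi ** x))"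
    using g by (intro Bruhat_double_coset_transpose orthogonal_matrix_mul rotation_orthogonal)
  then have "R pi ** (g ** R (- pi)) \<in> Bruhat_double_coset (R pi ** (x ** R (- pi)))"
    by (intro rotation_pi_left) (simp add: matrix_transpose_mul rotation_transpose g)
  moreover have "signed_perm (R pi ** x ** R (- pi)) \<sigma>"
    using signed_perm_mult[OF signed_perm_mult[OF rotation_pi(1) x(1)] rotation_pi(2)] by simp
  ultimately show ?thesis
    using x rotation_conj_involution[of g pi] unfolding in_cell_below_def involution_cell_def
    by (metis IntI IntD1 matrix_mul_assoc)
qed

end

section \<open>The two reductions of a cell\<close>

context adjacent
begin

text \<open>As \<tau> is increasing on \<open>p\<close>, \<open>q\<close>, the rotation on the left
  is an ascent, and transposition prepares a second one for the other side. Conversely,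
  \<open>rotation_reduce\<close> finds the angle on the left, and the involution property forces the
  same angle on the right.\<close>

lemma conj_cell:
  assumes w: "signed_perm w \<sigma>" and ww: "w ** w = mat 1" and desc: "\<sigma> q < \<sigma> p" and ne: "\<sigma> p \<noteq> q"
  defines "w' \<equiv> R (- (pi / 2)) ** w ** R (pi / 2)" and "\<tau> \<equiv> sw \<circ> \<sigma> \<circ> sw"
  shows "signed_perm w' \<tau>" "w' ** w' = mat 1" "trace w' = trace w"
    and "involution_dim \<sigma> = Suc (involution_dim \<tau>)"
    and "\<And>t h. \<lbrakk>0 < t; t < pi; h \<in> involution_cell w'\<rbrakk> \<Longrightarrow> R t ** h ** R (- t) \<in> involution_cell w"
    and "\<And>g. g \<in> involution_cell w \<Longrightarrow>
       \<exists>t h. 0 < t \<and> t < pi \<and> h \<in> involution_cell w' \<and> g = R t ** h ** R (- t)"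
    and "w \<noteq> w'"
proof -
  have wI: "w \<in> orthogonal_involutions"
    using ww signed_perm_orthogonal[OF w] by (simp add: orthogonal_involutions_def)
  show w': "signed_perm w' \<tau>"
    unfolding w'_def \<tau>_def
    using signed_perm_mult[OF signed_perm_mult[OF rotation_half_pi(2) w] rotation_half_pi(1)] .
  have w'I: "w' \<in> orthogonal_involutions"
    using rotation_conj_involution[OF wI, of "- (pi / 2)"] by (simp add: w'_def)
  then show w'w': "w' ** w' = mat 1" by (simp add: orthogonal_involutions_def)
  show "trace w' = trace w"
    using trace_rotation_conj[of "- (pi / 2)" w] by (simp add: w'_def)
  have tw': "transpose w' = w'" using w'I by (rule orthogonal_involutions_transpose)
  have ss: "\<sigma> \<circ> \<sigma> = id" and tt: "\<tau> \<circ> \<tau> = id"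
    using involution_cell_signed_perm(3)[OF signed_involution_cell] w ww w' w'w' by blast+
  have ss': "\<sigma> (\<sigma> i) = i" and tt': "\<tau> (\<tau> i) = i" for i
    using ss tt by (metis comp_apply id_apply)+
  have w_eq: "R (pi / 2) ** w' ** R (- (pi / 2)) = w" by (simp add: w'_def matrix_mul_assoc rotation_add)
  have "(\<sigma> q, \<sigma> p) \<noteq> (p, q)" using ne by auto
  then have asc: "\<tau> p < \<tau> q" using desc by (auto simp: \<tau>_def intro!: sw_less)
  have nf: "\<not> (\<tau> p = p \<and> \<tau> q = q)" using desc p_less_q by (auto simp: \<tau>_def)
  have st: "sw \<circ> \<tau> \<circ> sw = \<sigma>" by (auto simp: \<tau>_def)
  show "involution_dim \<sigma> = Suc (involution_dim \<tau>)"
    using involution_dim_conj[OF tt asc nf] by (simp add: st)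
  show "w \<noteq> w'"
  proof
    assume "w = w'"
    then have "\<sigma> = \<tau>" using signed_perm_unique w w' by blast
    then show False using asc desc by simp
  qed
  show "R t ** h ** R (- t) \<in> involution_cell w" if t: "0 < t" "t < pi" and h: "h \<in> involution_cell w'" for t h
  proof -
    have s: "0 < sin t" using t by (rule sin_gt_zero)
    have hI: "h \<in> orthogonal_involutions" and h': "h \<in> Bruhat_double_coset w'"
      and th: "transpose h = h" and oh: "orthogonal_matrix h"
      using h orthogonal_involutions_transpose by (auto simp: involution_cell_def orthogonal_involutions_def)
    have "R t ** h \<in> Bruhat_double_coset (R (pi / 2) ** w')"
      by (rule rotation_ascent[OF h' w' tt' tt' asc s])
    then have "transpose (R t ** h) \<in> Bruhat_double_coset (transpose (R (pi / 2) ** w'))"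
      using oh signed_perm_orthogonal[OF w']
      by (intro Bruhat_double_coset_transpose orthogonal_matrix_mul rotation_orthogonal)
    then have *: "h ** R (- t) \<in> Bruhat_double_coset (w' ** R (- (pi / 2)))"
      by (simp add: matrix_transpose_mul rotation_transpose th tw')
    \<comment> \<open>The permutation is now \<open>\<tau> \<circ> sw\<close>, which takes the
      values \<open>p\<close>, \<open>q\<close> at \<open>sw (\<tau> p)\<close>,
      \<open>sw (\<tau> q)\<close>; these are in increasing order because \<tau> does not fix both
      \<open>p\<close> and \<open>q\<close>.\<close>
    have "R t ** (h ** R (- t)) \<in> Bruhat_double_coset (R (pi / 2) ** (w' ** R (- (pi / 2))))"
      by (rule rotation_ascent[OF * signed_perm_mult[OF w' rotation_half_pi(2)], of "sw (\<tau> p)" "sw (\<tau> q)"])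
         (use nf in \<open>auto simp: tt' s intro!: sw_less asc\<close>)
    then show ?thesis
      using rotation_conj_involution[OF hI, of t] by (simp add: involution_cell_def matrix_mul_assoc w_eq)
  qed
  show "\<exists>t h. 0 < t \<and> t < pi \<and> h \<in> involution_cell w' \<and> g = R t ** h ** R (- t)"
    if g: "g \<in> involution_cell w" for g
  proof -
    have gI: "g \<in> orthogonal_involutions" and g': "g \<in> Bruhat_double_coset w" and og: "orthogonal_matrix g"
      using g by (auto simp: involution_cell_def orthogonal_involutions_def)
    obtain t where t: "0 < t" "t < pi" and 1: "R (- t) ** g \<in> Bruhat_double_coset (R (- (pi / 2)) ** w)"
      using g' by (rule rotation_reduce)
    have "orthogonal_matrix (R (- t) ** g)"
      using og by (intro orthogonal_matrix_mul rotation_orthogonal)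
    then obtain k :: int where
      k: "R (- t) ** g ** R t \<in> Bruhat_double_coset (R (- (pi / 2)) ** w ** R (of_int k * (pi / 2)))"
      using rotation_right[OF 1 signed_perm_mult[OF rotation_half_pi(2) w]] by blast
    \<comment> \<open>\<open>u\<close> is the deviation of the right-hand angle from the expected
      quarter turn; it remains to show that \<open>R u\<close> is the identity.\<close>
    define u where "u = of_int (k - 1) * (pi / 2)"
    have "R (of_int k * (pi / 2)) = R (pi / 2) ** R u"
      by (simp add: u_def rotation_add algebra_simps diff_divide_distrib)
    then have y: "R (- (pi / 2)) ** w ** R (of_int k * (pi / 2)) = w' ** R u"
      by (simp add: w'_def matrix_mul_assoc)
    have hI: "R (- t) ** g ** R t \<in> orthogonal_involutions"
      using rotation_conj_involution[OF gI, of "- t"] by simp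
    have "w' ** R u ** (w' ** R u) = mat 1"
      using k hI signed_perm_mult[OF w' rotation_quarter[of "k - 1"]] unfolding y
      by (intro involution_cell_signed_perm(2)[of "R (- t) ** g ** R t"]) (auto simp: involution_cell_def u_def)
    then have "w' ** R u ** w' ** R u ** R (- u) = R (- u)"
      by (simp add: matrix_mul_assoc del: rotation_cancel)
    then have e: "w' ** (R u ** w') = R (- u)" by (simp add: matrix_mul_assoc)
    \<comment> \<open>Conjugation by \<open>w'\<close> permutes the diagonal entries, and \<open>\<tau>\<close> does not preserve \<open>{p, q}\<close>.\<close>
    have d: "R (- u) $ \<tau> i $ \<tau> i = R u $ i $ i" for i
    proof -
      have "w' $ i $ \<tau> i = w' $ \<tau> i $ i"
        using tw' by (metis transpose_def vec_lambda_beta)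
      moreover have "w' $ \<tau> i $ i * w' $ \<tau> i $ i = 1"
        using signed_permD(2)[OF w', of i] by (metis abs_mult_self_eq mult_1)
      ultimately show ?thesis
        using signed_perm_mult_left[OF w', of "R u ** w'" i "\<tau> i"] mult_signed_perm[OF w', of "R u" i "\<tau> i"]
        by (simp add: e tt' mult.commute mult.left_commute)
    qed
    have "cos u = 1"
    proof (rule ccontr)
      assume "cos u \<noteq> 1"
      then have "\<tau> p \<in> {p, q}" "\<tau> q \<in> {p, q}"
        using d[of p] d[of q] by (auto simp: rotation_def split: if_splits)
      then show False using asc nf p_less_q by auto
    qed
    moreover then have "sin u = 0" using sin_cos_squared_add[of u] by simp
    ultimately have "R u = mat 1" by (auto simp: vec_eq_iff rotation_def mat_def)
    then have "R (- t) ** g ** R t \<in> involution_cell w'"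
      using k hI unfolding y by (simp add: involution_cell_def)
    moreover have "g = R t ** (R (- t) ** g ** R t) ** R (- t)"
      by (simp add: matrix_mul_assoc rotation_add)
    ultimately show ?thesis using t by blast
  qed
qed

text \<open>Here \<tau> fixes every index up to \<open>q\<close>, so
  \<open>orthogonal_fixed_columns\<close> pins the rows and columns \<open>p\<close>,
  \<open>q\<close> of \<open>h\<close> to those of \<open>w'\<close>. They form the reflection with
  entries \<open>e\<close>, \<open>- e\<close>, which reverses rotations.\<close>

lemma mult_cell:
  assumes w: "signed_perm w \<sigma>" and ww: "w ** w = mat 1" and pq: "\<sigma> p = q" and fixed: "\<forall>j<p. \<sigma> j = j"
  defines "w' \<equiv> R (- (pi / 2)) ** w" and "\<tau> \<equiv> sw \<circ> \<sigma>"
  shows "signed_perm w' \<tau>" "w' ** w' = mat 1" "trace w' = trace w"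
    and "involution_dim \<sigma> = Suc (involution_dim \<tau>)"
    and "\<And>t h. \<lbrakk>h \<in> closure (involution_cell w'); h \<in> orthogonal_involutions\<rbrakk> \<Longrightarrow> 
       R t ** h \<in> orthogonal_involutions \<and> trace (R t ** h) = trace h"
    and "\<And>t h. \<lbrakk>0 < t; t < pi; h \<in> involution_cell w'\<rbrakk> \<Longrightarrow> R t ** h \<in> involution_cell w"
    and "\<And>g. g \<in> involution_cell w \<Longrightarrow>
       \<exists>t h. 0 < t \<and> t < pi \<and> h \<in> involution_cell w' \<and> g = R t ** h"
    and "w \<noteq> w'"
proof -
  have wI: "w \<in> orthogonal_involutions"
    using ww signed_perm_orthogonal[OF w] by (simp add: orthogonal_involutions_def)
  show w': "signed_perm w' \<tau>"
    unfolding w'_def \<tau>_def using signed_perm_mult[OF rotation_half_pi(2) w] .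
  have w_eq: "R (pi / 2) ** w' = w" by (simp add: w'_def)
  have "\<sigma> \<circ> \<sigma> = id"
    using involution_cell_signed_perm(3)[OF signed_involution_cell] w ww by blast
  then have ss: "\<sigma> (\<sigma> i) = i" for i by (metis comp_apply id_apply)
  have qp: "\<sigma> q = p" using ss[of p] pq by simp
  have fixed': "\<tau> j = j" if "j \<le> q" for j
  proof -
    consider "j = q" | "j = p" | "j < p" using \<open>j \<le> q\<close> no_between[of j] by fastforce
    then show ?thesis using fixed pq qp p_less_q by cases (auto simp: \<tau>_def)
  qed
  have injt: "inj \<tau>" using signed_permD(1)[OF w'] by (rule bij_is_inj)
  show "involution_dim \<sigma> = Suc (involution_dim \<tau>)"
  proof -
    have "sw \<circ> \<tau> = \<sigma>" by (auto simp: \<tau>_def)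
    then show ?thesis using involution_dim_fixed[OF injt] fixed' p_less_q by simp
  qed
  show ne: "w \<noteq> w'"
  proof
    assume "w = w'"
    then have "\<sigma> = \<tau>" using signed_perm_unique w w' by blast
    then show False using fixed'[of p] pq p_less_q by simp
  qed
  define e where "e = w $ q $ p"
  have "w $ p $ q = e"
    using orthogonal_involutions_transpose[OF wI] unfolding e_def by (metis transpose_def vec_lambda_beta)
  moreover have "w $ p $ p = 0" "w $ q $ q = 0"
    using signed_permD(3)[OF w] pq qp by auto
  ultimately have w'pq: "w' $ p $ p = e" "w' $ q $ q = - e"
    by (simp_all add: w'_def rotation_mult e_def)
  have w'z: "w' $ i $ p = 0" "w' $ p $ i = 0" if "i \<noteq> p" for i
    using that signed_permD(3,4)[OF w'] fixed'[of p] p_less_q by (metis less_imp_le)+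
  have w'z': "w' $ i $ q = 0" "w' $ q $ i = 0" if "i \<noteq> q" for i
    using that signed_permD(3,4)[OF w'] fixed'[of q] by (metis order_refl)+
  define block where "block h \<longleftrightarrow> (\<forall>i. \<forall>j\<in>{p, q}. h $ i $ j = w' $ i $ j \<and> h $ j $ i = w' $ j $ i)" for h
  have block_w': "block w'" by (simp add: block_def)
  have block_closure: "block h" if "h \<in> closure (involution_cell w')" for h
    using orthogonal_fixed_columns_closure[OF that w' fixed'] p_less_q by (auto simp: block_def)
  \<comment> \<open>Stated without the involution property: surjectivity uses it to prove that
    \<open>R (- t) ** g\<close> is an involution.\<close>
  have block_coset: "block h" if "h \<in> Bruhat_double_coset w'" "orthogonal_matrix h" for h
    using orthogonal_fixed_columns[OF that w' fixed'] p_less_q by (auto simp: block_def)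
  have anti: "h ** R t = R (- t) ** h" if "block h" for h t
  proof -
    have h: "h $ p $ p = e" "h $ q $ q = - e"
      "\<And>i. i \<noteq> p \<Longrightarrow> h $ i $ p = 0" "\<And>i. i \<noteq> p \<Longrightarrow> h $ p $ i = 0"
      "\<And>i. i \<noteq> q \<Longrightarrow> h $ i $ q = 0" "\<And>i. i \<noteq> q \<Longrightarrow> h $ q $ i = 0"
      using that by (auto simp: block_def w'pq w'z w'z')
    show ?thesis
      unfolding vec_eq_iff mult_rotation rotation_mult using h by auto
  qed
  have sq: "(R t ** h) ** (R t ** h) = h ** h" if "block h" for h t
  proof -
    have "(R t ** h) ** (R t ** h) = R t ** (h ** R t) ** h" by (simp only: matrix_mul_assoc)
    also have "\<dots> = h ** h"
      unfolding anti[OF that] by (simp add: matrix_mul_assoc rotation_add)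
    finally show ?thesis .
  qed
  \<comment> \<open>Half of the rotation is moved across \<open>h\<close>, where its angle changes
    sign.\<close>
  have conj: "R t ** h = R (t / 2) ** h ** R (- (t / 2))" if "block h" for h t
    using anti[OF that, of "- (t / 2)"] by (simp add: matrix_mul_assoc[symmetric]) (simp add: matrix_mul_assoc rotation_add)
  show "w' ** w' = mat 1" using sq[OF block_w', of "pi / 2"] ww by (simp add: w_eq)
  show "trace w' = trace w"
    using conj[OF block_w', of "pi / 2"] trace_rotation_conj[of "pi / 2 / 2" w'] by (simp add: w_eq)
  show "R t ** h \<in> orthogonal_involutions \<and> trace (R t ** h) = trace h"
    if "h \<in> closure (involution_cell w')" "h \<in> orthogonal_involutions" for t h
    using conj[OF block_closure[OF that(1)], of t] trace_rotation_conj[of "t / 2" h]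
      rotation_conj_involution[OF that(2), of "t / 2"] by simp
  show "R t ** h \<in> involution_cell w" if t: "0 < t" "t < pi" and h: "h \<in> involution_cell w'" for t h
  proof -
    have hI: "h \<in> orthogonal_involutions" and h': "h \<in> Bruhat_double_coset w'" and oh: "orthogonal_matrix h"
      using h by (auto simp: involution_cell_def orthogonal_involutions_def)
    have "R t ** h \<in> Bruhat_double_coset (R (pi / 2) ** w')"
      using fixed' p_less_q sin_gt_zero[OF t] by (intro rotation_ascent[OF h' w', of p q]) auto
    moreover have "R t ** h \<in> orthogonal_involutions"
      using hI oh sq[OF block_coset[OF h' oh], of t]
      by (auto simp: orthogonal_involutions_def intro!: orthogonal_matrix_mul rotation_orthogonal)
    ultimately show ?thesis by (simp add: involution_cell_def w_eq)
  qed
  show "\<exists>t h. 0 < t \<and> t < pi \<and> h \<in> involution_cell w' \<and> g = R t ** h"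
    if g: "g \<in> involution_cell w" for g
  proof -
    have gI: "g ** g = mat 1" and g': "g \<in> Bruhat_double_coset w" and og: "orthogonal_matrix g"
      using g by (auto simp: involution_cell_def orthogonal_involutions_def)
    obtain t where t: "0 < t" "t < pi" and 1: "R (- t) ** g \<in> Bruhat_double_coset w'"
      using rotation_reduce[OF g'] unfolding w'_def by blast
    have o: "orthogonal_matrix (R (- t) ** g)"
      using og by (intro orthogonal_matrix_mul rotation_orthogonal)
    have "R (- t) ** g \<in> involution_cell w'"
      using 1 o gI sq[OF block_coset[OF 1 o], of t] by (simp add: involution_cell_def orthogonal_involutions_def)
    then show ?thesis using t by (intro exI[of _ t] exI[of _ "R (- t) ** g"]) simp
  qed
qed

end

text \<open>The second reduction needs fixed indices below \<open>p\<close>, so an arbitrary descent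
  is not enough. Let \<open>a\<close> be the least moved index, \<open>b = \<sigma> a\<close>, and
  \<open>p\<close> the last index below \<open>b\<close> that is sent to \<open>b\<close> or beyond;
  its successor \<open>q\<close> is sent below \<open>b\<close>. Then \<open>\<sigma> p = q\<close>
  is possible only for \<open>q = b\<close> and \<open>p = a\<close>, and everything below
  \<open>a\<close> is fixed.\<close>

lemma involution_descent:
  fixes \<sigma> :: "'n::{finite,wellorder} \<Rightarrow> 'n"
  assumes inv: "\<sigma> \<circ> \<sigma> = id" and "\<sigma> \<noteq> id"
  obtains p q where "adjacent p q" "\<sigma> q < \<sigma> p" "\<sigma> p = q \<Longrightarrow> \<forall>j<p. \<sigma> j = j"
proof -
  have ss: "\<sigma> (\<sigma> i) = i" for i using inv by (metis comp_apply id_apply)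
  define a where "a = (LEAST i. \<sigma> i \<noteq> i)"
  have "\<exists>i. \<sigma> i \<noteq> i" using assms(2) by auto
  then have a: "\<sigma> a \<noteq> a" unfolding a_def by (rule LeastI_ex)
  have below: "\<sigma> j = j" if "j < a" for j
    using not_less_Least[of j "\<lambda>i. \<sigma> i \<noteq> i"] that by (auto simp: a_def)
  define b where "b = \<sigma> a"
  have ab: "a < b" using a below[of b] ss[of a] unfolding b_def by (metis linorder_neqE)
  define S where "S = {i. i < b \<and> b \<le> \<sigma> i}"
  define p where "p = Max S"
  have "a \<in> S" using ab by (simp add: S_def b_def)
  then have pS: "p \<in> S" unfolding p_def by (intro Max_in) auto
  have pmax: "i \<notin> S" if "p < i" for i using that Max_ge[of S i] by (auto simp: p_def leD)
  define q where "q = (LEAST i. p < i)"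
  have pb: "p < b" "b \<le> \<sigma> p" using pS by (auto simp: S_def)
  have pq: "p < q" unfolding q_def using pb(1) by (rule LeastI)
  have qb: "q \<le> b" unfolding q_def using pb(1) by (rule Least_le)
  have "adjacent p q"
  proof
    show "k \<le> p" if "k < q" for k
      using not_less_Least[of k "\<lambda>i. p < i"] that by (auto simp: q_def)
  qed (rule pq)
  moreover have "\<sigma> q < \<sigma> p"
  proof (cases "q = b")
    case True
    then show ?thesis using ss[of a] ab pb by (simp add: b_def)
  next
    case False
    then show ?thesis using qb pmax[OF pq] pb by (auto simp: S_def)
  qed
  moreover have "\<sigma> j = j" if "\<sigma> p = q" "j < p" for j
  proof -
    have "q = b" using that(1) pb qb by simp
    then have "p = a" using that(1) ss b_def by metis
    then show ?thesis using below that by simp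
  qed
  ultimately show ?thesis using that by blast
qed

section \<open>Parametrisation of the cells by cubes\<close>

definition cube :: "nat \<Rightarrow> (nat \<Rightarrow> real) set" where
  "cube d = {x. (\<forall>i<d. \<bar>x i\<bar> \<le> 1) \<and> (\<forall>i\<ge>d. x i = 0)}"

definition open_cube :: "nat \<Rightarrow> (nat \<Rightarrow> real) set" where
  "open_cube d = {x. (\<forall>i<d. \<bar>x i\<bar> < 1) \<and> (\<forall>i\<ge>d. x i = 0)}"

text \<open>Cubes suit the induction, since a new angle is a new coordinate. The last clause is the
  boundary condition in a form to which one more rotation can be applied.\<close>

definition cell_param ::
    "real^'n::{finite,wellorder}^'n::{finite,wellorder} \<Rightarrow> nat
      \<Rightarrow> ((nat \<Rightarrow> real) \<Rightarrow> real^'n::{finite,wellorder}^'n::{finite,wellorder}) \<Rightarrow> bool" where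
  "cell_param w d \<Phi> \<longleftrightarrow>
     continuous_on (cube d) \<Phi> \<and>
     (\<forall>x\<in>cube d. \<Phi> x \<in> orthogonal_involutions \<and> trace (\<Phi> x) = trace w) \<and>
     bij_betw \<Phi> (open_cube d) (involution_cell w) \<and>
     (\<forall>x\<in>cube d - open_cube d. in_cell_below d (\<Phi> x))"

lemma open_cube_subset: "open_cube d \<subseteq> cube d"
  by (auto simp: cube_def open_cube_def less_imp_le)

text \<open>The segment from the origin to \<open>x\<close> stays in the open cube until its
  endpoint.\<close>

lemma cell_param_closure:
  assumes P: "cell_param w d \<Phi>" and x: "x \<in> cube d"
  shows "\<Phi> x \<in> closure (involution_cell w)"
proof -
  let ?f = "\<lambda>t i. t * x i"
  have 1: "?f ` {0..1} \<subseteq> cube d" and 2: "?f ` {0..<1} \<subseteq> open_cube d"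
  proof -
    have "t * \<bar>x i\<bar> \<le> t" if "0 \<le> t" "i < d" for t i
      using that x by (intro mult_left_le) (auto simp: cube_def)
    then show "?f ` {0..1} \<subseteq> cube d" "?f ` {0..<1} \<subseteq> open_cube d"
      using x by (force simp: cube_def open_cube_def abs_mult)+
  qed
  have cf: "continuous_on {0..1} ?f"
    by (intro continuous_on_coordinatewise_then_product continuous_intros)
  have "continuous_on (closure {0..<1}) (\<lambda>t. \<Phi> (?f t))"
    using P by (auto simp: cell_param_def intro!: continuous_on_compose2[OF _ cf 1])
  moreover have "(\<lambda>t. \<Phi> (?f t)) ` {0..<1} \<subseteq> closure (involution_cell w)"
    using 2 P closure_subset by (fastforce simp: cell_param_def bij_betw_def)
  ultimately have "(\<lambda>t. \<Phi> (?f t)) ` closure {0..<1} \<subseteq> closure (involution_cell w)"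
    by (intro image_closure_subset) auto
  then have "\<Phi> (?f 1) \<in> closure (involution_cell w)" by fastforce
  then show ?thesis by simp
qed

text \<open>Common frame of the two reductions, the last coordinate in \<open>[-1, 1]\<close> being
  rescaled to an angle in \<open>[0, pi]\<close>. The faces are of two kinds: at an extreme angle
  \<open>h\<close> may lie in the open cell and the dimension must not rise (\<open>ends\<close>);
  at any angle over a boundary point it may rise by one (\<open>step\<close>). Such boundary points
  are known to lie in the closure of the cell, which the exchange case needs.\<close>

lemma cell_param_extend:
  fixes T :: "real \<Rightarrow> real^'n::{finite,wellorder}^'n::{finite,wellorder} \<Rightarrow> real^'n::{finite,wellorder}^'n::{finite,wellorder}"
  assumes P: "cell_param w' d \<Phi>" and w': "signed_perm w' \<tau>" "involution_dim \<tau> = d"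
    and tr: "trace w' = trace w"
    and cont: "\<And>(S :: (nat \<Rightarrow> real) set) a f. continuous_on S a \<Longrightarrow> continuous_on S f \<Longrightarrow> continuous_on S (\<lambda>x. T (a x) (f x))"
    and inv: "\<And>t h. h \<in> closure (involution_cell w') \<Longrightarrow> h \<in> orthogonal_involutions \<Longrightarrow>
       T t h \<in> orthogonal_involutions \<and> trace (T t h) = trace h"
    and into: "\<And>t h. 0 < t \<Longrightarrow> t < pi \<Longrightarrow> h \<in> involution_cell w' \<Longrightarrow> T t h \<in> involution_cell w"
    and onto: "\<And>g. g \<in> involution_cell w \<Longrightarrow> \<exists>t h. 0 < t \<and> t < pi \<and> h \<in> involution_cell w' \<and> g = T t h"
    and inj: "\<And>s t g h. \<lbrakk>0 < s; s < pi; 0 < t; t < pi; g \<in> involution_cell w'; h \<in> involution_cell w'; T s g = T t h\<rbrakk>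
       \<Longrightarrow> s = t \<and> g = h"
    and ends: "\<And>t h. t = 0 \<or> t = pi \<Longrightarrow> h \<in> closure (involution_cell w') \<Longrightarrow> in_cell_below (Suc d) h
       \<Longrightarrow> in_cell_below (Suc d) (T t h)"
    and step: "\<And>t h. h \<in> closure (involution_cell w') \<Longrightarrow> in_cell_below d h \<Longrightarrow> in_cell_below (Suc d) (T t h)"
  shows "cell_param w (Suc d) (\<lambda>x. T (pi / 2 * (1 + x d)) (\<Phi> (x(d := 0))))"
proof -
  define s where "s x = pi / 2 * (1 + x d)" for x :: "nat \<Rightarrow> real"
  define r where "r x = x(d := 0)" for x :: "nat \<Rightarrow> real"
  have r: "r x \<in> cube d" if "x \<in> cube (Suc d)" for x
    using that by (auto simp: cube_def r_def)
  have abs1: "\<bar>y\<bar> < 1 \<longleftrightarrow> 0 < pi / 2 * (1 + y) \<and> pi / 2 * (1 + y) < pi" for y :: real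
  proof -
    have "0 < pi / 2 * (1 + y) \<longleftrightarrow> - 1 < y" by (auto simp: zero_less_mult_iff)
    moreover have "pi / 2 * (1 + y) < pi \<longleftrightarrow> y < 1" by (simp add: field_simps)
    ultimately show ?thesis by auto
  qed
  have o: "x \<in> open_cube (Suc d) \<longleftrightarrow> r x \<in> open_cube d \<and> 0 < s x \<and> s x < pi"
    if "\<forall>i\<ge>Suc d. x i = 0" for x
    unfolding s_def abs1[symmetric] using that by (auto simp: open_cube_def r_def less_Suc_eq Suc_le_eq)
  have ends_s: "s x = 0 \<or> s x = pi" if "x \<in> cube (Suc d)" "\<not> (0 < s x \<and> s x < pi)" for x
  proof -
    have "\<bar>x d\<bar> \<le> 1" "\<not> \<bar>x d\<bar> < 1" using that unfolding abs1 s_def cube_def by auto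
    then have "x d = 1 \<or> x d = -1" by linarith
    then show ?thesis by (auto simp: s_def)
  qed
  have c1: "continuous_on (cube (Suc d)) (\<lambda>x. s x)"
    unfolding s_def
    by (intro continuous_intros continuous_on_subset[OF continuous_on_product_coordinates]) auto
  have c2: "continuous_on (cube (Suc d)) r"
  proof (intro continuous_on_coordinatewise_then_product)
    show "continuous_on (cube (Suc d)) (\<lambda>x. r x i)" for i
      by (cases "i = d") (auto simp: r_def intro!: continuous_on_subset[OF continuous_on_product_coordinates])
  qed
  have "continuous_on (cube (Suc d)) (\<lambda>x. \<Phi> (r x))"
    using continuous_on_compose2[OF _ c2] P r by (auto simp: cell_param_def)
  then have 1: "continuous_on (cube (Suc d)) (\<lambda>x. T (s x) (\<Phi> (r x)))"
    using c1 by (intro cont)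
  have cl: "\<Phi> (r x) \<in> closure (involution_cell w')" if "x \<in> cube (Suc d)" for x
    using cell_param_closure[OF P r[OF that]] .
  have 2: "T (s x) (\<Phi> (r x)) \<in> orthogonal_involutions \<and> trace (T (s x) (\<Phi> (r x))) = trace w"
    if "x \<in> cube (Suc d)" for x
    using inv[OF cl[OF that]] P r[OF that] tr by (auto simp: cell_param_def)
  have bij: "bij_betw \<Phi> (open_cube d) (involution_cell w')" using P by (simp add: cell_param_def)
  have 3: "bij_betw (\<lambda>x. T (s x) (\<Phi> (r x))) (open_cube (Suc d)) (involution_cell w)"
    unfolding bij_betw_def
  proof (intro conjI equalityI subsetI inj_onI)
    fix x y assume xy: "x \<in> open_cube (Suc d)" "y \<in> open_cube (Suc d)"
      and eq: "T (s x) (\<Phi> (r x)) = T (s y) (\<Phi> (r y))"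
    have x: "r x \<in> open_cube d" "0 < s x" "s x < pi" using o[of x] xy by (auto simp: open_cube_def)
    have y: "r y \<in> open_cube d" "0 < s y" "s y < pi" using o[of y] xy by (auto simp: open_cube_def)
    have "s x = s y \<and> \<Phi> (r x) = \<Phi> (r y)"
      using x y bij eq by (intro inj) (auto simp: bij_betw_def)
    then have "x d = y d" "r x = r y" using x y bij by (auto simp: s_def bij_betw_def inj_on_def)
    then show "x = y" unfolding r_def by (metis fun_upd_triv fun_upd_upd)
  next
    fix g assume "g \<in> (\<lambda>x. T (s x) (\<Phi> (r x))) ` open_cube (Suc d)"
    then obtain x where x: "x \<in> open_cube (Suc d)" "g = T (s x) (\<Phi> (r x))" by blast
    then have "r x \<in> open_cube d" "0 < s x" "s x < pi" using o[of x] by (auto simp: open_cube_def)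
    then show "g \<in> involution_cell w"
      using bij into x(2) by (auto simp: bij_betw_def)
  next
    fix g assume "g \<in> involution_cell w"
    then obtain t h where th: "0 < t" "t < pi" "h \<in> involution_cell w'" "g = T t h" using onto by blast
    then obtain z where z: "z \<in> open_cube d" "h = \<Phi> z" using bij by (auto simp: bij_betw_def)
    define x where "x = z(d := 2 * t / pi - 1)"
    have "r x = z" using z(1) by (auto simp: r_def x_def open_cube_def fun_eq_iff)
    moreover have "s x = t" by (simp add: s_def x_def)
    moreover have "\<forall>i\<ge>Suc d. x i = 0" using z(1) by (auto simp: x_def open_cube_def)
    ultimately show "g \<in> (\<lambda>x. T (s x) (\<Phi> (r x))) ` open_cube (Suc d)"
      using o[of x] th z by (intro image_eqI[of _ _ x]) auto
  qed
  have 4: "in_cell_below (Suc d) (T (s x) (\<Phi> (r x)))" if x: "x \<in> cube (Suc d)" "x \<notin> open_cube (Suc d)" for x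
  proof (cases "r x \<in> open_cube d")
    case True
    then have "s x = 0 \<or> s x = pi"
      using ends_s[OF x(1)] o[of x] x by (auto simp: cube_def)
    moreover have "in_cell_below (Suc d) (\<Phi> (r x))"
      using True bij w' unfolding in_cell_below_def bij_betw_def by blast
    ultimately show ?thesis using ends cl[OF x(1)] by blast
  next
    case False
    then have "in_cell_below d (\<Phi> (r x))" using P r[OF x(1)] by (auto simp: cell_param_def)
    then show ?thesis using step cl[OF x(1)] by blast
  qed
  show ?thesis
    unfolding cell_param_def using 1 2 3 4 by (simp add: s_def r_def)
qed

section \<open>Induction on the dimension\<close>

lemma (in adjacent) continuous_on_rotation_mult:
  fixes f :: "'b::t2_space \<Rightarrow> real^'n::{finite,wellorder}^'n::{finite,wellorder}"
  assumes "continuous_on S a" "continuous_on S f"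
  shows "continuous_on S (\<lambda>x. R (a x) ** f x)"
proof -
  have "continuous_on S (\<lambda>x. (R (a x) ** f x) $ i $ j)" for i j
    unfolding rotation_mult using assms
    by (cases "i = p"; cases "i = q") (auto intro!: continuous_intros)
  then have "continuous_on S (\<lambda>x. \<chi> i j. (R (a x) ** f x) $ i $ j)"
    by (intro continuous_on_vec_lambda)
  then show ?thesis by simp
qed

lemma (in adjacent) continuous_on_mult_rotation:
  fixes f :: "'b::t2_space \<Rightarrow> real^'n::{finite,wellorder}^'n::{finite,wellorder}"
  assumes "continuous_on S a" "continuous_on S f"
  shows "continuous_on S (\<lambda>x. f x ** R (a x))"
proof -
  have "continuous_on S (\<lambda>x. (f x ** R (a x)) $ i $ j)" for i j
    unfolding mult_rotation using assms
    by (cases "j = p"; cases "j = q") (auto intro!: continuous_intros)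
  then have "continuous_on S (\<lambda>x. \<chi> i j. (f x ** R (a x)) $ i $ j)"
    by (intro continuous_on_vec_lambda)
  then show ?thesis by simp
qed

lemma (in adjacent) cell_param_conj:
  assumes w: "signed_perm w \<sigma>" "w ** w = mat 1" "\<sigma> q < \<sigma> p" "\<sigma> p \<noteq> q"
    and IH: "\<And>v \<tau>. \<lbrakk>signed_perm (v :: real^'n::{finite,wellorder}^'n::{finite,wellorder}) \<tau>; v ** v = mat 1; involution_dim \<tau> < involution_dim \<sigma>\<rbrakk> \<Longrightarrow> \<exists>\<Phi>. cell_param v (involution_dim \<tau>) \<Phi>"
  shows "\<exists>\<Phi>. cell_param w (involution_dim \<sigma>) \<Phi>"
proof -
  define w' where "w' = R (- (pi / 2)) ** w ** R (pi / 2)"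
  define \<tau> where "\<tau> = sw \<circ> \<sigma> \<circ> sw"
  note c = conj_cell[OF w, folded w'_def \<tau>_def]
  obtain \<Phi> where \<Phi>: "cell_param w' (involution_dim \<tau>) \<Phi>" using IH[OF c(1,2)] c(4) by auto
  \<comment> \<open>Source of injectivity: if two angles gave the same matrix, rotation by their
    difference would map a point of the cell of \<open>w'\<close> into that cell, but it lands in
    the cell of \<open>w\<close>, a different coset.\<close>
  have uniq: False if "g \<in> involution_cell w'" "R t ** g ** R (- t) \<in> involution_cell w'" "0 < t" "t < pi" for t g
    using c(5)[OF that(3,4,1)] that(2) Bruhat_unique[OF w(1) c(1)] c(7) by (auto simp: involution_cell_def)
  have shift: "R (t - s) ** h ** R (- (t - s)) = g"
    if "R s ** g ** R (- s) = R t ** h ** R (- t)" for s t g h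
  proof -
    have "R (t - s) ** h ** R (- (t - s)) = R (- s) ** (R t ** h ** R (- t)) ** R s"
      by (simp add: matrix_mul_assoc rotation_add) (simp add: rotation_add flip: matrix_mul_assoc)
    also have "\<dots> = R (- s) ** (R s ** g ** R (- s)) ** R s" using that by simp
    also have "\<dots> = g" by (simp add: matrix_mul_assoc rotation_add)
    finally show ?thesis .
  qed
  have "cell_param w (Suc (involution_dim \<tau>))
      (\<lambda>x. R (pi / 2 * (1 + x (involution_dim \<tau>))) ** \<Phi> (x(involution_dim \<tau> := 0)) ** R (- (pi / 2 * (1 + x (involution_dim \<tau>)))))"
  proof (rule cell_param_extend[OF \<Phi> c(1) refl c(3)])
    show "continuous_on S (\<lambda>x. R (a x) ** f x ** R (- a x))"
      if "continuous_on S a" "continuous_on S f" for S :: "(nat \<Rightarrow> real) set" and a f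
      using that by (intro continuous_on_mult_rotation continuous_on_rotation_mult continuous_intros)
    show "R t ** h ** R (- t) \<in> orthogonal_involutions \<and> trace (R t ** h ** R (- t)) = trace h"
      if "h \<in> orthogonal_involutions" for t h
      using that rotation_conj_involution trace_rotation_conj by blast
    show "s = t \<and> g = h"
      if st: "0 < s" "s < pi" "0 < t" "t < pi" and gh: "g \<in> involution_cell w'" "h \<in> involution_cell w'"
        and eq: "R s ** g ** R (- s) = R t ** h ** R (- t)" for s t g h
    proof -
      have "\<not> s < t" using uniq[of h "t - s"] shift[OF eq] st gh by auto
      moreover have "\<not> t < s" using uniq[of g "s - t"] shift[OF eq[symmetric]] st gh by auto
      ultimately have "s = t" by simp
      then show ?thesis using shift[OF eq] by simp
    qed
    show "in_cell_below (Suc (involution_dim \<tau>)) (R t ** h ** R (- t))"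
      if "t = 0 \<or> t = pi" "in_cell_below (Suc (involution_dim \<tau>)) h" for t h
      using that in_cell_below_rotation_pi_conj by auto
  qed (use c(5,6) in_cell_below_rotation_conj in blast)+
  then show ?thesis using c(4) by metis
qed

lemma (in adjacent) cell_param_mult:
  assumes w: "signed_perm w \<sigma>" "w ** w = mat 1" "\<sigma> p = q" "\<forall>j<p. \<sigma> j = j"
    and IH: "\<And>v \<tau>. \<lbrakk>signed_perm (v :: real^'n::{finite,wellorder}^'n::{finite,wellorder}) \<tau>; v ** v = mat 1; involution_dim \<tau> < involution_dim \<sigma>\<rbrakk> \<Longrightarrow> \<exists>\<Phi>. cell_param v (involution_dim \<tau>) \<Phi>"
  shows "\<exists>\<Phi>. cell_param w (involution_dim \<sigma>) \<Phi>"
proof -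
  define w' where "w' = R (- (pi / 2)) ** w"
  define \<tau> where "\<tau> = sw \<circ> \<sigma>"
  note c = mult_cell[OF w, folded w'_def \<tau>_def]
  obtain \<Phi> where \<Phi>: "cell_param w' (involution_dim \<tau>) \<Phi>" using IH[OF c(1,2)] c(4) by auto
  have uniq: False if "g \<in> involution_cell w'" "R t ** g \<in> involution_cell w'" "0 < t" "t < pi" for t g
    using c(6)[OF that(3,4,1)] that(2) Bruhat_unique[OF w(1) c(1)] c(8) by (auto simp: involution_cell_def)
  have shift: "R (t - s) ** h = g" if "R s ** g = R t ** h"
    for s t and g h :: "real^'n::{finite,wellorder}^'n::{finite,wellorder}"
  proof -
    have "R (t - s) ** h = R (- s) ** (R t ** h)" by (simp add: matrix_mul_assoc rotation_add)
    also have "\<dots> = R (- s) ** (R s ** g)" using that by simp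
    finally show ?thesis by simp
  qed
  \<comment> \<open>Points of smaller cells need not lie in the cell of \<open>w'\<close>;
    membership in its closure supplies the block form that keeps \<open>R t ** h\<close> an
    involution.\<close>
  have inv: "R t ** h \<in> orthogonal_involutions"
    if "h \<in> closure (involution_cell w')" "in_cell_below d h" for t d h
    using that c(5) by (auto simp: in_cell_below_def involution_cell_def)
  have "cell_param w (Suc (involution_dim \<tau>))
      (\<lambda>x. R (pi / 2 * (1 + x (involution_dim \<tau>))) ** \<Phi> (x(involution_dim \<tau> := 0)))"
  proof (rule cell_param_extend[OF \<Phi> c(1) refl c(3)])
    show "s = t \<and> g = h"
      if st: "0 < s" "s < pi" "0 < t" "t < pi" and gh: "g \<in> involution_cell w'" "h \<in> involution_cell w'"
        and eq: "R s ** g = R t ** h" for s t g h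
    proof -
      have "\<not> s < t" using uniq[of h "t - s"] shift[OF eq] st gh by auto
      moreover have "\<not> t < s" using uniq[of g "s - t"] shift[OF eq[symmetric]] st gh by auto
      ultimately have "s = t" by simp
      then show ?thesis using shift[OF eq] by simp
    qed
    show "in_cell_below (Suc (involution_dim \<tau>)) (R t ** h)"
      if "t = 0 \<or> t = pi" "h \<in> closure (involution_cell w')" "in_cell_below (Suc (involution_dim \<tau>)) h" for t h
      using that in_cell_below_rotation_pi_left inv[OF that(2,3), of pi] by auto
  qed (use c(5-7) inv in_cell_below_rotation_left continuous_on_rotation_mult in blast)+
  then show ?thesis using c(4) by metis
qed

lemma involution_cell_diagonal:
  assumes w: "signed_perm w id"
  shows "involution_cell w = {w}"
proof (intro equalityI subsetI)
  fix g assume "g \<in> involution_cell w"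
  then have "g \<in> Bruhat_double_coset w" "orthogonal_matrix g"
    by (auto simp: involution_cell_def orthogonal_involutions_def)
  then have "g $ i $ j = w $ i $ j" for i j
    by (rule orthogonal_fixed_columns(1)[OF _ _ w, of _ j]) auto
  then show "g \<in> {w}" by (simp add: vec_eq_iff)
next
  have "w ** w = mat 1"
    unfolding vec_eq_iff
  proof (intro allI)
    fix i j
    have "w $ j $ j * w $ j $ j = 1"
      using signed_permD(2)[OF w, of j] by (metis abs_mult_self_eq id_apply mult_1)
    then show "(w ** w) $ i $ j = mat 1 $ i $ j"
      using signed_permD(3)[OF w, of i j] by (auto simp: mult_signed_perm[OF w] mat_def)
  qed
  then show "g \<in> involution_cell w" if "g \<in> {w}" for g
    using that signed_involution_cell[OF w] by simp
qed

lemma cell_param_exists: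
  assumes "signed_perm w \<sigma>" "w ** w = mat 1"
  shows "\<exists>\<Phi>. cell_param w (involution_dim \<sigma>) \<Phi>"
  using assms
proof (induction "involution_dim \<sigma>" arbitrary: w \<sigma> rule: less_induct)
  case less
  note IH = less.hyps and w = less.prems
  have inv: "\<sigma> \<circ> \<sigma> = id"
    using involution_cell_signed_perm(3)[OF signed_involution_cell] w by blast
  show ?case
  proof (cases "\<sigma> = id")
    case True
    have "cube 0 = {\<lambda>_. 0}" "open_cube 0 = {\<lambda>_. 0}" by (auto simp: cube_def open_cube_def)
    moreover have "involution_cell w = {w}" using involution_cell_diagonal w True by blast
    moreover have "w \<in> orthogonal_involutions" using calculation(3) by (auto simp: involution_cell_def)
    ultimately have "cell_param w 0 (\<lambda>_. w)"
      by (simp add: cell_param_def bij_betw_def)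
    then show ?thesis using True involution_dim_id by metis
  next
    case False
    obtain p q where pq: "adjacent p q" "\<sigma> q < \<sigma> p" "\<sigma> p = q \<Longrightarrow> \<forall>j<p. \<sigma> j = j"
      using involution_descent[OF inv False] by metis
    interpret adjacent p q by (rule pq(1))
    show ?thesis
    proof (cases "\<sigma> p = q")
      case True
      then show ?thesis using cell_param_mult[OF w] pq(3) IH by blast
    next
      case False
      then show ?thesis using cell_param_conj[OF w pq(2)] IH by blast
    qed
  qed
qed

section \<open>The radial map from the disc to the cube\<close>

text \<open>The maximum norm of the first \<open>d\<close> coordinates; the recursion provides the
  value 0 for \<open>d = 0\<close>.\<close>

fun cube_norm :: "nat \<Rightarrow> (nat \<Rightarrow> real) \<Rightarrow> real" where
  "cube_norm 0 x = 0"
| "cube_norm (Suc d) x = max (cube_norm d x) \<bar>x d\<bar>"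

lemma cube_norm_nonneg: "0 \<le> cube_norm d x"
  by (induction d) auto

lemma cube_norm_le_iff: "0 \<le> c \<Longrightarrow> cube_norm d x \<le> c \<longleftrightarrow> (\<forall>i<d. \<bar>x i\<bar> \<le> c)"
  by (induction d) (auto simp: less_Suc_eq)

lemma cube_norm_less_iff: "0 < c \<Longrightarrow> cube_norm d x < c \<longleftrightarrow> (\<forall>i<d. \<bar>x i\<bar> < c)"
  by (induction d) (auto simp: less_Suc_eq)

lemma cube_norm_ge: "i < d \<Longrightarrow> \<bar>x i\<bar> \<le> cube_norm d x"
  using cube_norm_le_iff[OF cube_norm_nonneg, of d x d x] by auto

lemma cube_norm_scale: "0 \<le> c \<Longrightarrow> cube_norm d (\<lambda>i. c * x i) = c * cube_norm d x"
  by (induction d) (auto simp: abs_mult max_mult_distrib_left)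

lemma continuous_on_cube_norm: "continuous_on UNIV (cube_norm d)"
  by (induction d) (auto intro!: continuous_intros)

lemma continuous_on_L2_set: "continuous_on UNIV (\<lambda>x :: nat \<Rightarrow> real. L2_set x {..<d})"
  unfolding L2_set_def by (intro continuous_intros continuous_on_product_coordinates)

lemma cube_norm_eq_0_iff: "cube_norm d x = 0 \<longleftrightarrow> L2_set x {..<d} = 0"
proof -
  have "cube_norm d x = 0 \<longleftrightarrow> cube_norm d x \<le> 0" using cube_norm_nonneg[of d x] by auto
  then show ?thesis by (auto simp: cube_norm_le_iff L2_set_eq_0_iff)
qed

text \<open>Rescales each ray so that the Euclidean norm becomes the maximum norm. If the first
  \<open>d\<close> coordinates vanish, \<open>0 / 0 = 0\<close> gives the value 0.\<close>

definition radial :: "nat \<Rightarrow> (nat \<Rightarrow> real) \<Rightarrow> (nat \<Rightarrow> real)" where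
  "radial d x = (\<lambda>i. L2_set x {..<d} / cube_norm d x * x i)"

lemma cube_norm_radial: "cube_norm d (radial d x) = L2_set x {..<d}"
proof -
  have "cube_norm d (radial d x) = L2_set x {..<d} / cube_norm d x * cube_norm d x"
    unfolding radial_def by (rule cube_norm_scale) (simp add: cube_norm_nonneg)
  then show ?thesis using cube_norm_eq_0_iff[of d x] by auto
qed

lemma L2_set_scale: "0 \<le> c \<Longrightarrow> L2_set (\<lambda>i. c * x i) A = c * L2_set x A"
  by (simp add: L2_set_right_distrib)

lemma radial_zero:
  assumes "\<forall>i\<ge>d. x i = 0" "cube_norm d x = 0"
  shows "x = (\<lambda>_. 0)"
proof
  fix i show "x i = 0" using assms cube_norm_ge[of i d x] by (cases "i < d") auto
qed

text \<open>Equal images have preimages of equal Euclidean norm on the same ray.\<close>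

lemma radial_inj:
  assumes x: "\<forall>i\<ge>d. x i = 0" and y: "\<forall>i\<ge>d. y i = 0" and eq: "radial d x = radial d y"
  shows "x = y"
proof -
  have L: "L2_set x {..<d} = L2_set y {..<d}" using eq cube_norm_radial by metis
  show ?thesis
  proof (cases "cube_norm d x = 0")
    case True
    then have "cube_norm d y = 0" using L cube_norm_eq_0_iff by metis
    then show ?thesis using radial_zero x y True by metis
  next
    case False
    define c where "c = cube_norm d y / cube_norm d x"
    have ny: "cube_norm d y \<noteq> 0" using False L cube_norm_eq_0_iff by metis
    have Lx: "L2_set x {..<d} \<noteq> 0" using False cube_norm_eq_0_iff by metis
    have c: "0 \<le> c" using cube_norm_nonneg by (simp add: c_def)
    have yc: "y = (\<lambda>i. c * x i)"
    proof
      fix i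
      have "L2_set x {..<d} / cube_norm d x * x i = L2_set x {..<d} / cube_norm d y * y i"
        using fun_cong[OF eq, of i] L by (simp add: radial_def)
      then show "y i = c * x i" using Lx ny False by (simp add: c_def field_simps)
    qed
    have "L2_set y {..<d} = c * L2_set x {..<d}" unfolding yc using c by (rule L2_set_scale)
    then have "c = 1" using L Lx by simp
    then show ?thesis using yc by simp
  qed
qed

lemma radial_surj:
  assumes y: "\<forall>i\<ge>d. y i = 0"
  obtains x where "\<forall>i\<ge>d. x i = 0" "radial d x = y" "L2_set x {..<d} = cube_norm d y"
proof (cases "cube_norm d y = 0")
  case True
  then show ?thesis using that[of y] radial_zero[OF y True] cube_norm_eq_0_iff[of d y] y
    by (auto simp: radial_def)
next
  case False
  then have L: "L2_set y {..<d} \<noteq> 0" by (simp add: cube_norm_eq_0_iff)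
  define c where "c = cube_norm d y / L2_set y {..<d}"
  have c: "0 \<le> c" using cube_norm_nonneg by (simp add: c_def L2_set_nonneg)
  have c0: "c \<noteq> 0" using False L by (simp add: c_def)
  let ?x = "\<lambda>i. c * y i"
  have "L2_set ?x {..<d} = c * L2_set y {..<d}" using c by (rule L2_set_scale)
  also have "\<dots> = cube_norm d y" using L by (simp add: c_def)
  finally have "L2_set ?x {..<d} = cube_norm d y" .
  moreover then have "radial d ?x = y"
    using False c0 by (auto simp: radial_def cube_norm_scale[OF c])
  ultimately show ?thesis using that[of ?x] y by simp
qed

text \<open>Where the first \<open>d\<close> coordinates do not all vanish this is a quotient of
  continuous functions; elsewhere the bound by the Euclidean norm gives the limit 0. The coordinates
  from \<open>d\<close> on are zero on the stated domain.\<close>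

lemma continuous_on_radial: "continuous_on {x. \<forall>i\<ge>d. x i = 0} (radial d)"
proof (intro continuous_on_coordinatewise_then_product)
  fix i
  show "continuous_on {x. \<forall>i\<ge>d. x i = 0} (\<lambda>x. radial d x i)"
  proof (cases "i < d")
    case True
    have "isCont (\<lambda>x. radial d x i) x" for x
    proof (cases "cube_norm d x = 0")
      case False
      have "isCont (cube_norm d) x" "isCont (\<lambda>x. L2_set x {..<d}) x" "isCont (\<lambda>x :: nat \<Rightarrow> real. x i) x"
        using continuous_on_cube_norm continuous_on_L2_set continuous_on_product_coordinates
        by (metis UNIV_I continuous_on_eq_continuous_at open_UNIV)+
      then show ?thesis unfolding radial_def using False by (intro continuous_intros)
    next
      case z: True
      have le: "\<bar>radial d y i\<bar> \<le> L2_set y {..<d}" for y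
        using cube_norm_ge[OF True, of "radial d y"] by (simp add: cube_norm_radial)
      have "L2_set x {..<d} = 0" using z by (simp add: cube_norm_eq_0_iff)
      moreover have "isCont (\<lambda>x. L2_set x {..<d}) x"
        using continuous_on_L2_set by (simp add: continuous_on_eq_continuous_at)
      ultimately have "((\<lambda>y. L2_set y {..<d}) \<longlongrightarrow> 0) (at x)" by (simp add: isCont_def)
      then have "((\<lambda>y. radial d y i) \<longlongrightarrow> 0) (at x)"
        by (rule Lim_null_comparison[rotated]) (simp add: le)
      moreover have "radial d x i = 0" using z by (simp add: radial_def)
      ultimately show ?thesis by (simp add: isCont_def)
    qed
    then have "continuous_on UNIV (\<lambda>x. radial d x i)" by (simp add: continuous_on_eq_continuous_at)
    then show ?thesis by (rule continuous_on_subset) simp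
  next
    case False
    show ?thesis
      by (rule continuous_on_eq[of _ "\<lambda>_. 0"]) (use False in \<open>auto simp: radial_def\<close>)
  qed
qed

lemma closed_disc_eq:
  "closed_disc d = top_of_set {x. (\<forall>i\<ge>d. x i = 0) \<and> L2_set x {..<d} \<le> 1}"
  by (simp add: closed_disc_def Euclidean_space_def euclidean_product_topology subtopology_subtopology
      L2_set_def Collect_conj_eq)

lemma open_disc_eq:
  "open_disc d = top_of_set {x. (\<forall>i\<ge>d. x i = 0) \<and> L2_set x {..<d} < 1}"
  by (simp add: open_disc_def Euclidean_space_def euclidean_product_topology subtopology_subtopology
      L2_set_def Collect_conj_eq)

lemma radial_cube:
  assumes "\<forall>i\<ge>d. x i = 0"
  shows "radial d x \<in> cube d \<longleftrightarrow> L2_set x {..<d} \<le> 1"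
    "radial d x \<in> open_cube d \<longleftrightarrow> L2_set x {..<d} < 1"
proof -
  have "\<forall>i\<ge>d. radial d x i = 0" using assms by (simp add: radial_def)
  then show "radial d x \<in> cube d \<longleftrightarrow> L2_set x {..<d} \<le> 1"
    "radial d x \<in> open_cube d \<longleftrightarrow> L2_set x {..<d} < 1"
    using cube_norm_le_iff[of 1 d "radial d x"] cube_norm_less_iff[of 1 d "radial d x"]
    by (auto simp: cube_def open_cube_def cube_norm_radial)
qed

lemma bij_radial: "bij_betw (radial d) (topspace (open_disc d)) (open_cube d)"
  unfolding bij_betw_def open_disc_eq topspace_euclidean_subtopology
proof (intro conjI equalityI subsetI)
  show "inj_on (radial d) {x. (\<forall>i\<ge>d. x i = 0) \<and> L2_set x {..<d} < 1}"
    using radial_inj by (auto intro: inj_onI)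
  show "y \<in> open_cube d" if "y \<in> radial d ` {x. (\<forall>i\<ge>d. x i = 0) \<and> L2_set x {..<d} < 1}" for y
    using that radial_cube by auto
  fix y assume y: "y \<in> open_cube d"
  then obtain x where x: "\<forall>i\<ge>d. x i = 0" "radial d x = y" "L2_set x {..<d} = cube_norm d y"
    by (auto simp: open_cube_def intro: radial_surj)
  then show "y \<in> radial d ` {x. (\<forall>i\<ge>d. x i = 0) \<and> L2_set x {..<d} < 1}"
    using y radial_cube(2)[OF x(1)] by auto
qed

text \<open>By Tychonoff: the disc is closed in the product of infinitely many intervals
  \<open>[-1, 1]\<close>.\<close>

lemma compact_space_closed_disc: "compact_space (closed_disc d)"
proof -
  let ?D = "{x :: nat \<Rightarrow> real. (\<forall>i\<ge>d. x i = 0) \<and> L2_set x {..<d} \<le> 1}"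
  have "compactin (powertop_real UNIV) (PiE UNIV (\<lambda>_::nat. {-1..1::real}))"
    by (simp add: compactin_PiE)
  then have K: "compact (PiE UNIV (\<lambda>_::nat. {-1..1::real}))"
    by (simp add: euclidean_product_topology)
  have "?D = (\<Inter>i\<in>{d..}. {x. x i = 0}) \<inter> {x. L2_set x {..<d} \<le> 1}" by auto
  moreover have "closed ((\<Inter>i\<in>{d..}. {x :: nat \<Rightarrow> real. x i = 0}) \<inter> {x. L2_set x {..<d} \<le> 1})"
    by (intro closed_Int closed_INT ballI closed_Collect_eq closed_Collect_le continuous_on_L2_set
        continuous_on_product_coordinates continuous_on_const)
  ultimately have "closed ?D" by simp
  moreover have "?D \<subseteq> PiE UNIV (\<lambda>_::nat. {-1..1::real})"
  proof (clarsimp simp: PiE_def)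
    fix x :: "nat \<Rightarrow> real" and i
    assume x: "\<forall>i\<ge>d. x i = 0" "L2_set x {..<d} \<le> 1"
    have "\<bar>x i\<bar> \<le> 1"
    proof (cases "i < d")
      case True
      then have "\<bar>x i\<bar> \<le> L2_set (\<lambda>i. \<bar>x i\<bar>) {..<d}" by (intro member_le_L2_set) auto
      also have "\<dots> = L2_set x {..<d}" by (simp add: L2_set_def)
      finally show ?thesis using x by simp
    qed (use x in auto)
    then show "- 1 \<le> x i \<and> x i \<le> 1" by auto
  qed
  ultimately have "compact ?D" using closed_Int_compact[OF _ K, of ?D] by (simp add: inf.absorb1)
  then show ?thesis by (simp add: closed_disc_eq compact_space_subtopology)
qed

section \<open>The CW structure\<close>

lemma in_cell_below_disjoint:
  assumes "signed_perm w \<sigma>" "in_cell_below (involution_dim \<sigma>) g"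
  shows "g \<notin> involution_cell w"
proof
  assume g: "g \<in> involution_cell w"
  obtain v \<tau> where v: "signed_perm v \<tau>" "g \<in> involution_cell v" "involution_dim \<tau> < involution_dim \<sigma>"
    using assms by (auto simp: in_cell_below_def)
  then have "v = w" using g Bruhat_unique[OF v(1) assms(1)] by (auto simp: involution_cell_def)
  then show False using v signed_perm_unique assms(1) by blast
qed

text \<open>Continuity of the inverse comes from compactness: a continuous map from the closed disc
  to a Hausdorff space is closed, and it remains closed when restricted to the full preimage of the
  cell. That preimage is the open disc, because the boundary goes to other cells.\<close>

lemma cell_param_characteristic_map:
  assumes P: "cell_param w (involution_dim \<sigma>) \<Phi>" and w: "signed_perm w \<sigma>"
    and X: "X \<subseteq> orthogonal_involutions" "\<And>g. g \<in> orthogonal_involutions \<Longrightarrow> trace g = trace w \<Longrightarrow> g \<in> X"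
  defines "d \<equiv> involution_dim \<sigma>"
  shows "characteristic_map (top_of_set X) d (involution_cell w) (\<Phi> \<circ> radial d)"
    and "\<And>x. x \<in> disc_boundary d \<Longrightarrow> (\<Phi> \<circ> radial d) x \<in> X \<and> in_cell_below d ((\<Phi> \<circ> radial d) x)"
proof -
  let ?C = "{x. (\<forall>i\<ge>d. x i = 0) \<and> L2_set x {..<d} \<le> 1}"
  let ?O = "{x. (\<forall>i\<ge>d. x i = 0) \<and> L2_set x {..<d} < 1}"
  let ?F = "\<Phi> \<circ> radial d"
  have cubeX: "\<Phi> x \<in> X" if "x \<in> cube d" for x
    using P that X(2) by (auto simp: cell_param_def d_def)
  have C: "radial d ` ?C \<subseteq> cube d" using radial_cube by auto
  have bij: "bij_betw ?F ?O (involution_cell w)"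
    using bij_betw_trans[OF bij_radial[of d]] P by (auto simp: cell_param_def d_def open_disc_eq)
  show bd: "?F x \<in> X \<and> in_cell_below d (?F x)" if "x \<in> disc_boundary d" for x
    using that P radial_cube[of d x] cubeX
    by (auto simp: disc_boundary_def closed_disc_eq open_disc_eq cell_param_def d_def)
  have cont: "continuous_map (closed_disc d) (top_of_set X) ?F"
    unfolding closed_disc_eq continuous_map_subtopology_eu
  proof
    have "continuous_on ?C (radial d)"
      by (rule continuous_on_subset[OF continuous_on_radial]) auto
    then show "continuous_on ?C ?F"
      using P C continuous_on_subset[of "cube d" \<Phi>] by (intro continuous_on_compose) (auto simp: cell_param_def d_def)
    show "?F \<in> ?C \<rightarrow> X" using C cubeX by (auto simp: image_subset_iff)
  qed
  have cellX: "involution_cell w \<subseteq> X"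
  proof
    fix g assume "g \<in> involution_cell w"
    then have "g \<in> \<Phi> ` open_cube d" using P by (simp add: cell_param_def d_def bij_betw_def)
    then obtain z where "z \<in> open_cube d" "g = \<Phi> z" by blast
    then show "g \<in> X" using cubeX open_cube_subset by blast
  qed
  have "closed_map (closed_disc d) (top_of_set X) ?F"
    using cont compact_space_closed_disc
    by (intro T1_Spaces.continuous_imp_closed_map) (simp_all add: Hausdorff_space_subtopology)
  moreover have "{x \<in> topspace (closed_disc d). ?F x \<in> involution_cell w} = ?O"
  proof (intro equalityI subsetI)
    fix x assume x: "x \<in> {x \<in> topspace (closed_disc d). ?F x \<in> involution_cell w}"
    then have "x \<notin> disc_boundary d" using bd in_cell_below_disjoint[OF w] by (auto simp: d_def)
    then show "x \<in> ?O" using x by (auto simp: disc_boundary_def closed_disc_eq open_disc_eq)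
  next
    fix x assume "x \<in> ?O"
    then show "x \<in> {x \<in> topspace (closed_disc d). ?F x \<in> involution_cell w}"
      using bij by (auto simp: closed_disc_eq bij_betw_def)
  qed
  ultimately have "closed_map (subtopology (closed_disc d) ?O) (subtopology (top_of_set X) (involution_cell w)) ?F"
    by (rule closed_map_restriction)
  moreover have so: "subtopology (closed_disc d) ?O = open_disc d"
  proof -
    have "?C \<inter> ?O = ?O" by auto
    then show ?thesis by (simp add: closed_disc_eq open_disc_eq subtopology_subtopology)
  qed
  ultimately have cm: "closed_map (open_disc d) (subtopology (top_of_set X) (involution_cell w)) ?F" by simp
  have "homeomorphic_map (open_disc d) (subtopology (top_of_set X) (involution_cell w)) ?F"
  proof (rule bijective_closed_imp_homeomorphic_map[OF _ cm])
    have "continuous_map (open_disc d) (top_of_set X) ?F"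
      using continuous_map_from_subtopology[OF cont, of ?O] so by simp
    then show "continuous_map (open_disc d) (subtopology (top_of_set X) (involution_cell w)) ?F"
      using bij by (auto simp: continuous_map_in_subtopology open_disc_eq bij_betw_def)
    show "?F ` topspace (open_disc d) = topspace (subtopology (top_of_set X) (involution_cell w))"
      using bij cellX by (auto simp: open_disc_eq bij_betw_def)
    show "inj_on ?F (topspace (open_disc d))"
      using bij by (simp add: open_disc_eq bij_betw_def)
  qed
  then show "characteristic_map (top_of_set X) d (involution_cell w) ?F"
    using cont by (simp add: characteristic_map_def)
qed

text \<open>The double coset itself does not control the trace; the parametrisation does.\<close>

lemma trace_involution_cell:
  assumes "g \<in> involution_cell w" "signed_perm w \<sigma>"
  shows "trace g = trace w"
proof -
  obtain \<Phi> where P: "cell_param w (involution_dim \<sigma>) \<Phi>"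
    using cell_param_exists assms involution_cell_signed_perm(2) by blast
  then have "g \<in> \<Phi> ` open_cube (involution_dim \<sigma>)"
    using assms(1) by (simp add: cell_param_def bij_betw_def)
  then obtain z where "z \<in> open_cube (involution_dim \<sigma>)" "g = \<Phi> z" by blast
  then show ?thesis using P open_cube_subset by (auto simp: cell_param_def)
qed

lemma finite_signed_permutation_matrices:
  "finite {w :: real^'n::finite^'n::finite. signed_permutation_matrix w}"
proof (rule finite_subset)
  let ?S = "PiE (UNIV :: 'n set) (\<lambda>_. PiE (UNIV :: 'n set) (\<lambda>_. {0, 1, -1 :: real}))"
  show "finite ((\<lambda>f. \<chi> i j. f i j) ` ?S)" by (intro finite_imageI finite_PiE) auto
  show "{w :: real^'n^'n. signed_permutation_matrix w} \<subseteq> (\<lambda>f. \<chi> i j. f i j) ` ?S"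
  proof
    fix w :: "real^'n^'n" assume "w \<in> {w. signed_permutation_matrix w}"
    then obtain \<sigma> where w: "signed_perm w \<sigma>" by (auto simp: signed_permutation_matrix_iff)
    have "w $ i $ j \<in> {0, 1, -1}" for i j
      using signed_permD(2)[OF w, of j] signed_permD(3)[OF w, of i j] by (cases "i = \<sigma> j") (auto simp: abs_if split: if_splits)
    then show "w \<in> (\<lambda>f. \<chi> i j. f i j) ` ?S"
      by (intro image_eqI[of _ _ "\<lambda>i j. w $ i $ j"]) auto
  qed
qed

theorem mainTheorem1:
  fixes k :: nat
  assumes "k \<le> CARD('n::{finite,wellorder})"
  shows "open_cells_of_CW_structure
           (top_of_set (Grassmann k :: (real^'n::{finite,wellorder}^'n::{finite,wellorder}) set))
           {w :: real^'n::{finite,wellorder}^'n::{finite,wellorder}. signed_permutation_matrix w \<and> w ** w = mat 1 \<and>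
              trace w = real CARD('n) - 2 * real k}
           (\<lambda>w. Grassmann k \<inter> Bruhat_double_coset w)"
proof -
  let ?G = "Grassmann k :: (real^'n::{finite,wellorder}^'n::{finite,wellorder}) set"
  define I where "I = {w :: real^'n::{finite,wellorder}^'n::{finite,wellorder}. signed_permutation_matrix w \<and> w ** w = mat 1 \<and>
              trace w = real CARD('n) - 2 * real k}"
  let ?e = "\<lambda>w. ?G \<inter> Bruhat_double_coset w"
  have G: "?G = {g \<in> orthogonal_involutions. trace g = real CARD('n) - 2 * real k}"
    by (auto simp: Grassmann_def orthogonal_involutions_def)
  have "\<forall>w\<in>I. \<exists>\<sigma>. signed_perm w \<sigma>" by (auto simp: I_def signed_permutation_matrix_iff)
  then obtain perm where perm: "\<And>w. w \<in> I \<Longrightarrow> signed_perm w (perm w)" by metis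
  have "\<forall>w\<in>I. \<exists>\<Phi>. cell_param w (involution_dim (perm w)) \<Phi>"
    using perm cell_param_exists by (auto simp: I_def)
  then obtain \<Phi> where \<Phi>: "\<And>w. w \<in> I \<Longrightarrow> cell_param w (involution_dim (perm w)) (\<Phi> w)" by metis
  define dm where "dm w = involution_dim (perm w)" for w
  define \<Psi> where "\<Psi> w = \<Phi> w \<circ> radial (dm w)" for w
  \<comment> \<open>By constancy of the trace, intersecting with this Grassmannian cuts nothing off
    the cell.\<close>
  have e: "?e w = involution_cell w" if "w \<in> I" for w
    using that trace_involution_cell[OF _ perm[OF that]] by (auto simp: I_def G involution_cell_def)
  have cellI: "v \<in> I" if "g \<in> ?G" "g \<in> involution_cell v" "signed_perm v \<tau>" for g v \<tau>
    using that trace_involution_cell[OF that(2,3)] involution_cell_signed_perm(2)[OF that(2,3)]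
    by (auto simp: I_def G signed_permutation_matrix_iff)
  have fin: "finite I" by (rule finite_subset[OF _ finite_signed_permutation_matrices]) (auto simp: I_def)
  have haus: "Hausdorff_space (top_of_set ?G)" by (simp add: Hausdorff_space_subtopology)
  have disj: "disjoint_family_on ?e I"
    unfolding disjoint_family_on_def using Bruhat_unique[OF perm perm] by blast
  have union: "(\<Union>w\<in>I. ?e w) = topspace (top_of_set ?G)"
  proof (intro equalityI subsetI)
    fix g assume "g \<in> topspace (top_of_set ?G)"
    then have g: "g \<in> ?G" by simp
    then have "invertible g" by (auto simp: Grassmann_def orthogonal_matrix_def invertible_def)
    then obtain w \<sigma> where w: "signed_perm w \<sigma>" "g \<in> Bruhat_double_coset w" by (rule Bruhat_exists)
    then have "w \<in> I" using g by (intro cellI[OF g _ w(1)]) (auto simp: involution_cell_def G)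
    then show "g \<in> (\<Union>w\<in>I. ?e w)" using g w by blast
  qed auto
  have char: "characteristic_map (top_of_set ?G) (dm w) (?e w) (\<Psi> w)" if w: "w \<in> I" for w
    unfolding e[OF w] \<Psi>_def dm_def
    using w by (intro cell_param_characteristic_map(1)[OF \<Phi>[OF w] perm[OF w]]) (auto simp: I_def G)
  \<comment> \<open>There are finitely many cells in all, so every cell of smaller dimension may be
    put into \<open>J\<close>.\<close>
  have bdry: "\<exists>J. finite J \<and> J \<subseteq> {v \<in> I. dm v < dm w} \<and>
      \<Psi> w ` disc_boundary (dm w) \<subseteq> (\<Union>v\<in>J. ?e v)" if w: "w \<in> I" for w
  proof (intro exI[of _ "{v \<in> I. dm v < dm w}"] conjI)
    show "finite {v \<in> I. dm v < dm w}" using fin by (rule rev_finite_subset) auto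
    show "\<Psi> w ` disc_boundary (dm w) \<subseteq> (\<Union>v\<in>{v \<in> I. dm v < dm w}. ?e v)"
    proof (rule image_subsetI)
      fix x assume "x \<in> disc_boundary (dm w)"
      then have "\<Psi> w x \<in> ?G \<and> in_cell_below (dm w) (\<Psi> w x)"
        unfolding \<Psi>_def dm_def
        using w by (intro cell_param_characteristic_map(2)[OF \<Phi>[OF w] perm[OF w]]) (auto simp: I_def G)
      then obtain v \<tau> where v: "signed_perm v \<tau>" "\<Psi> w x \<in> involution_cell v" "involution_dim \<tau> < dm w"
        and g: "\<Psi> w x \<in> ?G"
        by (auto simp: in_cell_below_def)
      have vI: "v \<in> I" using cellI[OF g v(2,1)] .
      have "dm v < dm w" using v signed_perm_unique[OF v(1) perm[OF vI]] by (simp add: dm_def)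
      then show "\<Psi> w x \<in> (\<Union>v\<in>{v \<in> I. dm v < dm w}. ?e v)"
        using vI v(2) e[OF vI] by blast
    qed
  qed auto
  \<comment> \<open>With finitely many cells, \<open>A\<close> is a finite union of the closed
    pieces.\<close>
  have weak: "closedin (top_of_set ?G) A \<longleftrightarrow>
      (\<forall>w\<in>I. closedin (top_of_set ?G) (A \<inter> top_of_set ?G closure_of ?e w))"
    if A: "A \<subseteq> topspace (top_of_set ?G)" for A
  proof
    assume cl: "\<forall>w\<in>I. closedin (top_of_set ?G) (A \<inter> top_of_set ?G closure_of ?e w)"
    have "?e w \<subseteq> top_of_set ?G closure_of ?e w" for w by (rule closure_of_subset) auto
    then have "(\<Union>w\<in>I. ?e w) \<subseteq> (\<Union>w\<in>I. top_of_set ?G closure_of ?e w)" by (rule UN_mono[OF subset_refl])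
    then have "A \<subseteq> (\<Union>w\<in>I. top_of_set ?G closure_of ?e w)" unfolding union by (rule order_trans[OF A])
    then have "A = (\<Union>w\<in>I. A \<inter> top_of_set ?G closure_of ?e w)"
      unfolding Int_UN_distrib[symmetric] by (simp add: inf.absorb1)
    moreover have "closedin (top_of_set ?G) (\<Union>w\<in>I. A \<inter> top_of_set ?G closure_of ?e w)"
      using fin cl by (intro closedin_Union) auto
    ultimately show "closedin (top_of_set ?G) A" by simp
  qed (simp add: closedin_Int)
  have "CW_structure (top_of_set ?G) I ?e dm \<Psi>"
    unfolding CW_structure_def
    by (intro conjI ballI allI impI haus disj union char bdry weak)
  then show ?thesis unfolding open_cells_of_CW_structure_def I_def by blast
qed

end
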